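(* There exists a universal constant $C$ such that the following holds. Let $\Omega\subset\mathbb R^2$ be a compact convex set, $X:=\Omega\cap\mathbb Z^2$, and assume that the convex hull $\mathrm{Hull}(X)$ has non-empty interior. Let $\mathcal V$ be a family of stencils on $X$, and let $u\in\mathrm{Conv}(\mathcal V)$. Then any (standard) Delaunay triangulation of $X$ can be transformed into a $u$-Delaunay triangulation of $X$ via a sequence of at most $C\,\#(\mathcal V)$ edge flips. (The constant $C$ is independent of $u,\mathcal V,\Omega$.)
   Context: $\|\cdot\|$ is the Euclidean norm. A vector $e=(\alpha,\beta)\in\mathbb Z^2$ is irreducible iff $\gcd(\alpha,\beta)=1$. A basis of $\mathbb Z^2$ is a pair $(f,g)\in(\mathbb Z^2)^2$ with $|\det(f,g)|=1$; direct iff $\det(f,g)=1$, acute iff $\langle f,g\rangle\ge0$. For each irreducible $e$ with $\|e\|>1$ there is a unique direct acute basis $(f,g)$ with $e=f+g$; $f,g$ are called the parents of $e$. Unit vectors have no parents. Linear forms: $S_x^e(u):=u(x+e)-2u(x)+u(x-e)$ for $e$ irreducible; for $e$ irreducible with $\|e\|>1$, of parents $f,g$, $T_x^e(u):=u(x+e)+u(x-f)+u(x-g)-3u(x)$ and $P_x^e(u):=u(x+e)-u(x+f)-u(x+g)+u(x)$. The support of a form is the set of points at which $u$ is evaluated. $\mathcal V_{\max}(x):=\{e\in\mathbb Z^2\text{ irreducible}: x+e\in X\}$. $\mathrm{Cone}(A)$ is the convex cone generated by $A$, with $\mathrm{Cone}(\emptyset)=\{0\}$. A family of stencils on $X$ is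 a collection $\mathcal V=(\mathcal V(x))_{x\in X}$, $\mathcal V(x)\subseteq\mathcal V_{\max}(x)$, such that for all $x\in X$: (Stability) any parent $f\in\mathcal V_{\max}(x)$ of any $e\in\mathcal V(x)$ satisfies $f\in\mathcal V(x)$; (Visibility) $\mathrm{Cone}(\mathcal V(x))=\mathrm{Cone}(\mathcal V_{\max}(x))$. The candidates for refinement $\hat{\mathcal V}(x)$ are all $e\in\mathcal V_{\max}(x)\setminus\mathcal V(x)$ having two parents, both in $\mathcal V(x)$. $\#(\mathcal V):=\sum_{x\in X}\#(\mathcal V(x))$. $\mathrm{Conv}(\mathcal V)$ is the set of $u:X\to\mathbb R$ such that for all $x\in X$: $S_x^e(u)\ge0$ for all $e\in\mathcal V(x)$ with $S_x^e$ supported in $X$; $T_x^e(u)\ge0$ for all $e\in\mathcal V(x)$, $\|e\|>1$, with $T_x^e$ supported in $X$; $P_x^e(u)\ge0$ for all $e\in\hat{\mathcal V}(x)$. A triangulation $\mathcal T$ of $X$ is a (conforming) triangulation covering $\mathrm{Hull}(X)$ whose set of vertices is exactly $X$. For $u:X\to\mathbb R$, $\mathcal T$ is $u$-Delaunay iff the piecewise linear interpolation $\mathrm I_{\mathcal T}u:\mathrm{Hull}(X)\to\mathbb R$ is convex. A (standard) Delaunay triangulation is a $q$-Delaunay triangulation with $q(x):=\frac12\|x\|^2$. An edge flip: if two triangles $[x,y,t]$ and $[x,z,t]$ of $\mathcal T$ share the edge $[x,t]$ and their union is a convex quadrilateral of diagonals $[x,t]$ and $[y,z]$, replace the edge $[x,t]$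 by $[y,z]$ (i.e. the two triangles by $[x,y,z]$ and $[t,y,z]$). *)

theory Defs
  imports "HOL-Analysis.Analysis"
begin

text \<open>Points and offsets of the grid \<open>\<int>\<^sup>2\<close> are elements of \<open>int \<times> int\<close>; the product norm
  on \<open>real \<times> real\<close> is the Euclidean one.\<close>

type_synonym point = "int \<times> int"

definition emb :: "point \<Rightarrow> real \<times> real" where
  "emb p = (real_of_int (fst p), real_of_int (snd p))"

definition grid :: "(real \<times> real) set \<Rightarrow> point set" where
  "grid \<Omega> = {p. emb p \<in> \<Omega>}"

definition Hull :: "point set \<Rightarrow> (real \<times> real) set" where
  "Hull A = convex hull (emb ` A)"

definition irreducible_vec :: "point \<Rightarrow> bool" where
  "irreducible_vec e \<longleftrightarrow> gcd (fst e) (snd e) = 1"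

definition det2 :: "point \<Rightarrow> point \<Rightarrow> int" where
  "det2 f g = fst f * snd g - snd f * fst g"

definition direct_basis :: "point \<Rightarrow> point \<Rightarrow> bool" where
  "direct_basis f g \<longleftrightarrow> det2 f g = 1"

definition acute_basis :: "point \<Rightarrow> point \<Rightarrow> bool" where
  "acute_basis f g \<longleftrightarrow> \<bar>det2 f g\<bar> = 1 \<and> emb f \<bullet> emb g \<ge> 0"

text \<open>\<open>parents e f g\<close>: \<open>(f, g)\<close> is the direct acute basis with \<open>e = f + g\<close>. It exists, and is
  then unique, exactly when \<open>e\<close> is irreducible and not a unit vector.\<close>

definition parents :: "point \<Rightarrow> point \<Rightarrow> point \<Rightarrow> bool" where
  "parents e f g \<longleftrightarrow> irreducible_vec e \<and> norm (emb e) > 1 \<and>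
     direct_basis f g \<and> acute_basis f g \<and> e = f + g"

definition parent :: "point \<Rightarrow> point \<Rightarrow> bool" where
  "parent e f \<longleftrightarrow> (\<exists>g. parents e f g \<or> parents e g f)"

definition Vmax :: "point set \<Rightarrow> point \<Rightarrow> point set" where
  "Vmax X x = {e. irreducible_vec e \<and> x + e \<in> X}"

text \<open>A convex cone is nonempty in the library, so \<open>Cone {} = {0}\<close>.\<close>

definition Cone :: "point set \<Rightarrow> (real \<times> real) set" where
  "Cone A = convex_cone hull (emb ` A)"

definition stencils :: "point set \<Rightarrow> (point \<Rightarrow> point set) \<Rightarrow> bool" where
  "stencils X V \<longleftrightarrow> (\<forall>x\<in>X.
     V x \<subseteq> Vmax X x \<and>
     (\<forall>e\<in>V x. \<forall>f\<in>Vmax X x. parent e f \<longrightarrow> f \<in> V x) \<and>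
     Cone (V x) = Cone (Vmax X x))"

definition candidates :: "point set \<Rightarrow> (point \<Rightarrow> point set) \<Rightarrow> point \<Rightarrow> point set" where
  "candidates X V x =
     {e \<in> Vmax X x - V x. \<exists>f g. parents e f g \<and> f \<in> V x \<and> g \<in> V x}"

definition stencils_card :: "point set \<Rightarrow> (point \<Rightarrow> point set) \<Rightarrow> nat" where
  "stencils_card X V = (\<Sum>x\<in>X. card (V x))"

definition S_form :: "point \<Rightarrow> point \<Rightarrow> (point \<Rightarrow> real) \<Rightarrow> real" where
  "S_form e x u = u (x + e) - 2 * u x + u (x - e)"

definition T_form :: "point \<Rightarrow> point \<Rightarrow> point \<Rightarrow> point \<Rightarrow> (point \<Rightarrow> real) \<Rightarrow> real" where
  "T_form e f g x u = u (x + e) + u (x - f) + u (x - g) - 3 * u x"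

definition P_form :: "point \<Rightarrow> point \<Rightarrow> point \<Rightarrow> point \<Rightarrow> (point \<Rightarrow> real) \<Rightarrow> real" where
  "P_form e f g x u = u (x + e) - u (x + f) - u (x + g) + u x"

text \<open>A function on \<open>X\<close> is represented by a total function, of which only the values on \<open>X\<close>
  are used. No support condition is needed for \<open>P_form\<close>: if \<open>e \<in> candidates X V x\<close> then
  \<open>x + e\<close>, \<open>x + f\<close> and \<open>x + g\<close> lie in \<open>X\<close>.\<close>

definition Conv :: "point set \<Rightarrow> (point \<Rightarrow> point set) \<Rightarrow> (point \<Rightarrow> real) set" where
  "Conv X V = {u. \<forall>x\<in>X.
     (\<forall>e\<in>V x. {x + e, x, x - e} \<subseteq> X \<longrightarrow> S_form e x u \<ge> 0) \<and>
     (\<forall>e\<in>V x. \<forall>f g. parents e f g \<and> {x + e, x - f, x - g, x} \<subseteq> X \<longrightarrow> T_form e f g x u \<ge> 0) \<and>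
     (\<forall>e\<in>candidates X V x. \<forall>f g. parents e f g \<longrightarrow> P_form e f g x u \<ge> 0)}"

text \<open>A triangulation is given by the vertex triples of its triangles; the library's
  \<open>triangulation\<close> requires finitely many simplices, any two of which meet in a common face.\<close>

definition is_triangulation :: "point set \<Rightarrow> point set set \<Rightarrow> bool" where
  "is_triangulation X \<T> \<longleftrightarrow>
     (\<forall>t\<in>\<T>. card t = 3 \<and> \<not> affine_dependent (emb ` t)) \<and>
     triangulation (Hull ` \<T>) \<and>
     \<Union> (Hull ` \<T>) = Hull X \<and>
     \<Union> \<T> = X"

text \<open>Piecewise linear interpolation, in barycentric coordinates. The value does not depend on
  the triangle \<open>t\<close> containing \<open>p\<close>, since two triangles meet in a common face.\<close>

definition interp :: "point set set \<Rightarrow> (point \<Rightarrow> real) \<Rightarrow> real \<times> real \<Rightarrow> real" where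
  "interp \<T> u p = (THE y. \<exists>t\<in>\<T>. \<exists>w :: point \<Rightarrow> real.
     (\<forall>v\<in>t. 0 \<le> w v) \<and> sum w t = 1 \<and>
     p = (\<Sum>v\<in>t. w v *\<^sub>R emb v) \<and> y = (\<Sum>v\<in>t. w v * u v))"

definition delaunay :: "point set \<Rightarrow> (point \<Rightarrow> real) \<Rightarrow> point set set \<Rightarrow> bool" where
  "delaunay X u \<T> \<longleftrightarrow> is_triangulation X \<T> \<and> convex_on (Hull X) (interp \<T> u)"

definition q :: "point \<Rightarrow> real" where
  "q x = (norm (emb x))\<^sup>2 / 2"

definition standard_delaunay :: "point set \<Rightarrow> point set set \<Rightarrow> bool" where
  "standard_delaunay X \<T> \<longleftrightarrow> delaunay X q \<T>"

text \<open>The union of the triangles \<open>[x,y,t]\<close> and \<open>[x,z,t]\<close> must be a convex quadrilateral with the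
  four distinct corners \<open>x, y, t, z\<close>; in particular none of these lies on a segment between two
  of the others, so that the new triangles are nondegenerate.\<close>

definition edge_flip :: "point set set \<Rightarrow> point set set \<Rightarrow> bool" where
  "edge_flip \<T> \<T>' \<longleftrightarrow> (\<exists>x y z t.
     {x, y, t} \<in> \<T> \<and> {x, z, t} \<in> \<T> \<and> card {x, y, z, t} = 4 \<and>
     convex (Hull {x, y, t} \<union> Hull {x, z, t}) \<and>
     {p. p extreme_point_of (Hull {x, y, t} \<union> Hull {x, z, t})} = emb ` {x, y, z, t} \<and>
     open_segment (emb x) (emb t) \<inter> open_segment (emb y) (emb z) \<noteq> {} \<and>
     \<T>' = (\<T> - {{x, y, t}, {x, z, t}}) \<union> {{x, y, z}, {t, y, z}})"

end

theory Submission
  imports Defs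
begin

text \<open>The constant is \<open>C = 1\<close>. Every triangle is unimodular, and \<open>u\<close> is convex on \<open>X\<close>, so an interior edge
  across which the interpolation of \<open>u\<close> fails to be convex is always a diagonal of a parallelogram, and
  can be flipped. As long as such edges exist, flip one of them, in any order. Starting from a
  Delaunay triangulation, every flip then replaces a diagonal by one which is at least as long, so that
  the new edge \<open>[y, y + e]\<close> is created from the parents of \<open>e\<close> and satisfies \<open>P_form e f g y u < 0\<close>. The
  hierarchical structure of the stencils shows that this forces \<open>e \<in> V y\<close>. Since the interpolation
  decreases with every flip, no edge is created twice, whence at most \<open>#(V)\<close> flips.\<close>

section \<open>Acute bases of the integer grid\<close>

text \<open>Flips are driven by \<open>u\<close>, whereas lengths belong to \<open>q\<close>. The
  bridge is \<open>no_long_edges\<close>, which compares values of \<open>u\<close> rather than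
  lengths. Convexity of the interpolation of \<open>q\<close> rules out long diagonals at the start.
  Afterwards a long diagonal is present only because a flip inserted it, and flipping it back would
  need the reverse of the strict inequality that paid for the insertion.

  Only parallelograms are flipped because the vectors \<open>a\<close>, \<open>b\<close> from one
  end of an edge \<open>c\<close> to the two opposite vertices satisfy \<open>a + b = k c\<close>
  with an integer \<open>k\<close>. The forms \<open>S_form\<close> and \<open>T_form\<close> yield
  convexity across the edge for every \<open>k\<close> except \<open>k = 1\<close>.

  The arithmetic core is that \<open>P_form\<close> is imposed on the candidates alone, just outside
  the stencil, but must be nonnegative for every offset outside it. Descent along parents leads
  there, and the points it evaluates must lie in \<open>X\<close>. Visibility guarantees this, since
  it provides stencil elements on either side of the missing offset.\<close>

definition ip :: "point \<Rightarrow> point \<Rightarrow> int" where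
  "ip f g = fst f * fst g + snd f * snd g"

lemma inner_emb: "emb f \<bullet> emb g = of_int (ip f g)"
  by (simp add: emb_def ip_def)

lemma norm_emb_gt_1: "norm (emb e) > 1 \<longleftrightarrow> ip e e > 1"
proof -
  have "norm (emb e) > 1 \<longleftrightarrow> real_of_int (ip e e) > 1"
    by (simp add: norm_eq_sqrt_inner inner_emb)
  then show ?thesis by linarith
qed

lemma emb_add: "emb (a + b) = emb a + emb b"
  and emb_diff: "emb (a - b) = emb a - emb b"
  by (simp_all add: emb_def)

lemma inj_emb: "inj emb"
  by (auto simp: inj_def emb_def prod_eq_iff)

lemma emb_eq_iff: "emb a = emb b \<longleftrightarrow> a = b"
  using inj_emb by (auto dest: injD)

lemma irreducible_vecI:
  assumes "\<bar>det2 e h\<bar> = 1" shows "irreducible_vec e"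
proof -
  have "gcd (fst e) (snd e) dvd det2 e h" by (simp add: det2_def)
  then have "gcd (fst e) (snd e) dvd 1"
    by (metis assms dvd_abs_iff)
  then show ?thesis by (simp add: irreducible_vec_def)
qed

lemma lagrange_identity: "ip f f * ip g g = (ip f g)\<^sup>2 + (det2 f g)\<^sup>2"
  by (simp add: ip_def det2_def algebra_simps power2_eq_square)

lemma ip_self_nonneg: "ip f f \<ge> 0"
  by (simp add: ip_def)

lemma ip_self_pos: "f \<noteq> 0 \<Longrightarrow> ip f f \<ge> 1"
proof -
  assume "f \<noteq> 0"
  then have "fst f * fst f > 0 \<or> snd f * snd f > 0"
    by (auto simp: prod_eq_iff zero_less_mult_iff)
  then show ?thesis using zero_le_square[of "fst f"] zero_le_square[of "snd f"]
    by (auto simp: ip_def simp del: zero_le_square)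
qed

lemma det2_nonzero: "det2 f g \<noteq> 0 \<Longrightarrow> f \<noteq> 0 \<and> g \<noteq> 0"
  by (auto simp: det2_def)

text \<open>Since the angle is acute, the squared length of \<open>f + g\<close> is at least the sum
  of those of \<open>f\<close> and \<open>g\<close>, hence at least 2. The determinant makes the sum
  irreducible.\<close>

lemma parents_iff: "parents e f g \<longleftrightarrow> det2 f g = 1 \<and> ip f g \<ge> 0 \<and> e = f + g"
proof -
  have "irreducible_vec e \<and> norm (emb e) > 1" if d: "det2 f g = 1" and i: "ip f g \<ge> 0" and e: "e = f + g"
  proof
    have "det2 e g = 1" using d e by (simp add: det2_def algebra_simps)
    then show "irreducible_vec e" by (intro irreducible_vecI[of _ g]) simp
    have "ip e e = ip f f + ip g g + 2 * ip f g" by (simp add: e ip_def algebra_simps)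
    moreover have "ip f f \<ge> 1" "ip g g \<ge> 1" using det2_nonzero[of f g] d ip_self_pos by auto
    ultimately show "norm (emb e) > 1" using i by (simp add: norm_emb_gt_1)
  qed
  then show ?thesis
    by (auto simp: parents_def direct_basis_def acute_basis_def inner_emb)
qed

lemma parents_Vmax: "parents e f g \<Longrightarrow> x + e \<in> X \<Longrightarrow> e \<in> Vmax X x"
  unfolding parents_def Vmax_def by blast

lemma det2_swap: "det2 g f = - det2 f g"
  by (simp add: det2_def)

text \<open>Bezout gives \<open>h\<close> with \<open>det2 h e = 1\<close>, and a multiple of
  \<open>e\<close> is subtracted so that \<open>m = ip f e\<close> satisfies
  \<open>0 \<le> m < N\<close>. By Lagrange's identity \<open>ip f f * N = m\<^sup>2 + 1\<close>.
  This excludes \<open>m = 0\<close>, and as \<open>m\<^sup>2 + 1 \<le> m * N\<close> it gives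
  \<open>ip f f \<le> m\<close>, that is \<open>ip f (e - f) \<ge> 0\<close>.\<close>

lemma parents_exist:
  assumes "irreducible_vec e" "ip e e > 1" shows "\<exists>f g. parents e f g"
proof -
  define N where "N = ip e e"
  obtain a b where ab: "a * fst e + b * snd e = 1"
    using bezout_int[of "fst e" "snd e"] assms(1) by (auto simp: irreducible_vec_def)
  define h :: point where "h = (b, - a)"
  have h: "det2 h e = 1" using ab by (simp add: h_def det2_def algebra_simps)
  define k where "k = ip h e div N"
  define f :: point where "f = (fst h - k * fst e, snd h - k * snd e)"
  have f: "det2 f e = 1" using h by (simp add: f_def det2_def algebra_simps)
  have "ip f e = ip h e - k * N" by (simp add: f_def N_def ip_def algebra_simps)
  then have m: "ip f e = ip h e mod N" by (simp add: k_def minus_div_mult_eq_mod)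
  have N: "N > 1" using assms N_def by simp
  then have m1: "0 \<le> ip f e" "ip f e < N" by (simp_all add: m)
  have L: "ip f f * N = (ip f e)\<^sup>2 + 1" using lagrange_identity[of f e] f N_def by simp
  have "ip f e \<noteq> 0"
  proof
    assume "ip f e = 0"
    then have "ip f f * N = 1" using L by simp
    then show False using N by (metis abs_zmult_eq_1 abs_of_pos less_irrefl mult.commute order.strict_trans zero_less_one)
  qed
  then have m2: "ip f e \<ge> 1" using m1 by simp
  have "1 \<le> ip f e * (N - ip f e)" using m2 m1 mult_mono[of 1 "ip f e" 1 "N - ip f e"] by simp
  then have "ip f f * N \<le> ip f e * N" using L by (simp add: algebra_simps power2_eq_square)
  then have le: "ip f f \<le> ip f e" using N by simp
  have "ip f (e - f) = ip f e - ip f f" by (simp add: ip_def algebra_simps)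
  moreover have "det2 f (e - f) = 1" using f by (simp add: det2_def algebra_simps)
  ultimately show ?thesis using le by (intro exI[of _ f] exI[of _ "e - f"]) (simp add: parents_iff)
qed

text \<open>One step of the descent: subtracting the shorter parent from the longer one keeps the
  basis acute, so \<open>f - g\<close> and \<open>g\<close> are the parents of \<open>f\<close>.
  Otherwise the product of the squared lengths would be at least
  \<open>(ip f g + 2) * (ip f g + 1)\<close>, too large for Lagrange's identity.\<close>

lemma acute_longer:
  assumes "\<bar>det2 f g\<bar> = 1" "ip f g \<ge> 0" "ip f f > ip g g" shows "ip f g \<ge> ip g g"
proof (rule ccontr)
  assume "\<not> ?thesis"
  then have 1: "ip f g + 1 \<le> ip g g" by simp
  then have "(ip f g + 2) * (ip f g + 1) \<le> ip f f * ip g g"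
    using assms by (intro mult_mono) auto
  moreover have "(det2 f g)\<^sup>2 = 1" using assms(1) by (metis one_power2 power2_abs)
  ultimately show False using lagrange_identity[of f g] assms by (simp add: algebra_simps power2_eq_square)
qed

text \<open>The base of the descent. The difference of the squares of \<open>ip f f\<close> and
  \<open>ip f g\<close> equals 1 and factors over the integers.\<close>

lemma acute_same_length:
  assumes "det2 f g = 1" "ip f g \<ge> 0" "ip f f = ip g g" shows "ip f f = 1"
proof -
  have L: "(ip f f)\<^sup>2 = (ip f g)\<^sup>2 + 1" using lagrange_identity[of f g] assms by (simp add: power2_eq_square)
  have p: "ip f f \<ge> 1" using det2_nonzero[of f g] assms(1) ip_self_pos by auto
  have "(ip f f + ip f g) * (ip f f - ip f g) = 1" using L by (simp add: algebra_simps power2_eq_square)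
  then have "ip f f + ip f g = 1" using p assms(2)
    by (smt (verit) zmult_eq_1_iff)
  then show ?thesis using p assms(2) by simp
qed

text \<open>The Stern-Brocot splitting of a primitive vector of the quadrant, obtained from the
  subtractive Euclidean algorithm.\<close>

lemma coprime_split:
  fixes i j :: int
  assumes "i \<ge> 1" "j \<ge> 1" "coprime i j"
  shows "\<exists>i1 j1 i2 j2. i1 \<ge> 0 \<and> j1 \<ge> 0 \<and> i2 \<ge> 0 \<and> j2 \<ge> 0 \<and> i1 + i2 = i \<and> j1 + j2 = j \<and> i1 * j2 - i2 * j1 = 1"
  using assms
proof (induction "nat (i + j)" arbitrary: i j rule: less_induct)
  case less
  consider "i = j" | "i > j" | "i < j" by linarith
  then show ?case
  proof cases
    case 1
    then have "i = 1" using less.prems by simp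
    then show ?thesis using 1 by (intro exI[of _ 1] exI[of _ 0]) auto
  next
    case 2
    have "coprime (i - j) j" using less.prems(3) by (metis coprime_iff_gcd_eq_1 gcd_diff1)
    with less.hyps[of "i - j" j] 2 less.prems obtain i1 j1 i2 j2 where
      *: "i1 \<ge> 0" "j1 \<ge> 0" "i2 \<ge> 0" "j2 \<ge> 0" "i1 + i2 = i - j" "j1 + j2 = j" "i1 * j2 - i2 * j1 = 1"
      by force
    show ?thesis
      by (rule exI[of _ "i1 + j1"], rule exI[of _ j1], rule exI[of _ "i2 + j2"], rule exI[of _ j2])
        (use * in \<open>auto simp: algebra_simps\<close>)
  next
    case 3
    have "coprime i (j - i)" using less.prems(3)
      by (metis coprime_commute coprime_iff_gcd_eq_1 gcd_diff1)
    with less.hyps[of i "j - i"] 3 less.prems obtain i1 j1 i2 j2 where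
      *: "i1 \<ge> 0" "j1 \<ge> 0" "i2 \<ge> 0" "j2 \<ge> 0" "i1 + i2 = i" "j1 + j2 = j - i" "i1 * j2 - i2 * j1 = 1"
      by force
    show ?thesis
      by (rule exI[of _ i1], rule exI[of _ "j1 + i1"], rule exI[of _ i2], rule exI[of _ "j2 + i2"])
        (use * in \<open>auto simp: algebra_simps\<close>)
  qed
qed

text \<open>Two direct bases with sum \<open>e\<close> are related by \<open>f' = f + k e\<close>,
  \<open>g' = g - k e\<close>. In the expansion of \<open>ip f' g'\<close> the factors
  \<open>k\<^sup>2 - k\<close> and \<open>k\<^sup>2 + k\<close> are nonnegative for integers
  \<open>k\<close>, and one of them is positive unless \<open>k = 0\<close>; hence
  \<open>ip f' g' < 0\<close> for all other \<open>k\<close>.\<close>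

lemma acute_basis_unique:
  assumes d: "det2 f g = 1" "det2 f' g' = 1" and "ip f g \<ge> 0" "ip f' g' \<ge> 0"
    and e: "f + g = f' + g'"
  shows "f' = f \<and> g' = g"
proof -
  define k where "k = det2 f f'"
  have g': "g' = f + g - f'" using e by simp
  have k: "det2 f' g = k + 1"
  proof -
    have "det2 f' g' = det2 f' g - det2 f f'" by (simp add: g' det2_def algebra_simps)
    then show ?thesis using d k_def by simp
  qed
  have c: "fst v * det2 f g = det2 v g * fst f + det2 f v * fst g"
     "snd v * det2 f g = det2 v g * snd f + det2 f v * snd g" for v
    by (simp_all add: det2_def algebra_simps)
  have f': "fst f' = fst f + k * (fst f + fst g)" "snd f' = snd f + k * (snd f + snd g)"
    using c[of f'] d k k_def by (simp_all add: algebra_simps)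
  have "ip f' g' = ip f g + k * (ip g g - ip f f) - k\<^sup>2 * (ip f f + ip g g + 2 * ip f g)"
    by (simp add: g' ip_def f' algebra_simps power2_eq_square)
  also have "\<dots> = ip f g * (1 - 2 * k\<^sup>2) - (k\<^sup>2 - k) * ip g g - (k\<^sup>2 + k) * ip f f"
    by (simp add: algebra_simps)
  finally have eq: "ip f' g' = ip f g * (1 - 2 * k\<^sup>2) - (k\<^sup>2 - k) * ip g g - (k\<^sup>2 + k) * ip f f" .
  have pos: "ip f f \<ge> 1" "ip g g \<ge> 1" using det2_nonzero[of f g] d ip_self_pos by auto
  have "k = 0"
  proof (rule ccontr)
    assume "k \<noteq> 0"
    then have k2: "k\<^sup>2 \<ge> 1" by (metis zero_less_power2 int_one_le_iff_zero_less)
    then have "ip f g * (1 - 2 * k\<^sup>2) \<le> 0" using assms(3) by (simp add: mult_le_0_iff)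
    moreover have "(k\<^sup>2 - k) * ip g g + (k\<^sup>2 + k) * ip f f > 0"
    proof (cases "k > 0")
      case True
      have "k\<^sup>2 - k \<ge> 0" using True by (simp add: power2_eq_square)
      then have "(k\<^sup>2 - k) * ip g g \<ge> 0" using pos by simp
      moreover have "(k\<^sup>2 + k) * ip f f > 0" using True pos k2 by (intro mult_pos_pos) linarith+
      ultimately show ?thesis by linarith
    next
      case False
      have "k\<^sup>2 + k = k * (k + 1)" by (simp add: algebra_simps power2_eq_square)
      moreover have "k * (k + 1) \<ge> 0" using False \<open>k \<noteq> 0\<close> by (intro mult_nonpos_nonpos) auto
      ultimately have "(k\<^sup>2 + k) * ip f f \<ge> 0" using pos by simp
      moreover have "(k\<^sup>2 - k) * ip g g > 0" using False pos k2 \<open>k \<noteq> 0\<close> by (intro mult_pos_pos) linarith+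
      ultimately show ?thesis by linarith
    qed
    ultimately show False using eq assms(4) by linarith
  qed
  then have "f' = f" using f' by (simp add: prod_eq_iff)
  then show ?thesis using g' by simp
qed

text \<open>Barycentric weights \<open>m / d\<close> and \<open>n / d\<close> are given by integers
  over a common denominator, so that uses of the lemma are purely integral.\<close>

lemma tri_hull_mem:
  assumes "x \<in> X" "x + f \<in> X" "x + g \<in> X" "m \<ge> 0" "n \<ge> 0" "m + n \<le> d" "d > 0"
    and "d * fst h = m * fst f + n * fst g" "d * snd h = m * snd f + n * snd g"
  shows "emb (x + h) \<in> Hull X"
proof -
  let ?m = "real_of_int m / real_of_int d" and ?n = "real_of_int n / real_of_int d"
  have "real_of_int (d * fst h) = real_of_int (m * fst f + n * fst g)"
    "real_of_int (d * snd h) = real_of_int (m * snd f + n * snd g)" using assms by simp_all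
  then have h: "real_of_int (fst h) = ?m * fst f + ?n * fst g" "real_of_int (snd h) = ?m * snd f + ?n * snd g"
    using assms(7) by (simp_all add: field_simps)
  have "emb (x + h) = (1 - ?m - ?n) *\<^sub>R emb x + ?m *\<^sub>R emb (x + f) + ?n *\<^sub>R emb (x + g)"
    by (simp add: emb_def h algebra_simps)
  moreover have "?m \<ge> 0" "?n \<ge> 0" using assms by simp_all
  moreover have "1 - ?m - ?n \<ge> 0"
  proof -
    have "?m + ?n = real_of_int (m + n) / real_of_int d" by (simp add: add_divide_distrib)
    also have "\<dots> \<le> 1" using assms(6,7) by (simp del: of_int_add)
    finally show ?thesis by simp
  qed
  ultimately have "emb (x + h) \<in> convex hull {emb x, emb (x + f), emb (x + g)}"
    unfolding convex_hull_3
    by (intro CollectI exI[of _ "1 - ?m - ?n"] exI[of _ ?m] exI[of _ ?n]) simp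
  moreover have "convex hull {emb x, emb (x + f), emb (x + g)} \<subseteq> Hull X"
    unfolding Hull_def using assms by (intro hull_mono) auto
  ultimately show ?thesis by blast
qed

text \<open>The form in which Visibility is applied: an open half plane containing an available
  offset contains one of the stencil. Otherwise the closed opposite half plane, a convex cone, would
  contain the whole visible cone.\<close>

lemma cone_functional_pos:
  assumes "e \<in> A" "Cone B = Cone A" "linear l" "l (emb e) > 0"
  shows "\<exists>b\<in>B. l (emb b) > (0::real)"
proof (rule ccontr)
  assume *: "\<not> ?thesis"
  interpret linear l by fact
  have "convex_cone {p. l p \<le> 0}"
    unfolding convex_cone_def
    by (auto simp: conic_def convex_def add scale mult_nonneg_nonpos add_nonpos_nonpos zero_prod_def[symmetric] intro!: exI[of _ 0])
  then have "Cone B \<subseteq> {p. l p \<le> 0}" unfolding Cone_def using * by (intro hull_minimal) auto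
  moreover have "emb e \<in> Cone A" unfolding Cone_def using assms(1) by (intro hull_inc) auto
  ultimately show False using assms by auto
qed

locale lattice_polygon =
  fixes X :: "point set"
  assumes finite_X: "finite X"
    and lattice_convex: "emb p \<in> Hull X \<Longrightarrow> p \<in> X"
begin

lemma tri_mem:
  assumes "x \<in> X" "x + f \<in> X" "x + g \<in> X" "m \<ge> 0" "n \<ge> 0" "m + n \<le> d" "d > 0"
    and "d * fst h = m * fst f + n * fst g" "d * snd h = m * snd f + n * snd g"
  shows "x + h \<in> X"
  by (rule lattice_convex, rule tri_hull_mem[OF assms])

end

section \<open>Inequalities satisfied on a stencil cone\<close>

locale stencil_cone = lattice_polygon +
  fixes V :: "point \<Rightarrow> point set" and u :: "point \<Rightarrow> real"
  assumes stencils: "stencils X V" and u: "u \<in> Conv X V"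
begin

lemma V_Vmax: "x \<in> X \<Longrightarrow> e \<in> V x \<Longrightarrow> e \<in> Vmax X x"
  using stencils by (auto simp: stencils_def)

text \<open>Descend from \<open>a\<close> to its ancestor \<open>e\<close> through the parents lying in the triangle \<open>0, e, a\<close>: as \<open>X\<close> is
  convex, these offsets are available at \<open>x\<close>, so that Stability applies.\<close>

lemma ancestor_in_V:
  assumes x: "x \<in> X" and e: "e \<in> Vmax X x" and d: "\<bar>det2 e g\<bar> = 1" and a: "ip e g \<ge> 0"
    and "a \<in> V x" "i \<ge> 1" "j \<ge> 0"
    and "fst a = i * fst e + j * fst g" "snd a = i * snd e + j * snd g"
  shows "e \<in> V x"
  using assms(5-)
proof (induction "nat j" arbitrary: a i j rule: less_induct)
  case less
  have irr: "irreducible_vec a" using V_Vmax[OF x less.prems(1)] by (simp add: Vmax_def)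
  have "gcd i j dvd gcd (fst a) (snd a)" by (simp add: less.prems)
  then have cop: "coprime i j" using irr by (simp only: irreducible_vec_def is_unit_gcd)
  show ?case
  proof (cases "j = 0")
    case True
    then have "i = 1" using cop less.prems by simp
    then have "a = e" using True less.prems by (simp add: prod_eq_iff)
    then show ?thesis using less.prems by simp
  next
    case False
    then have "j \<ge> 1" using less.prems by simp
    \<comment> \<open>Nonnegative coordinates in the acute basis \<open>e, g\<close> make the two
      summands of \<open>a\<close> acute again, so they are its parents. The one with
      \<open>i1 \<ge> 1\<close> keeps a positive share of \<open>e\<close> and a smaller share of
      \<open>g\<close>.\<close>
    from coprime_split[OF less.prems(2) this cop] obtain i1 j1 i2 j2 where
      s: "i1 \<ge> 0" "j1 \<ge> 0" "i2 \<ge> 0" "j2 \<ge> 0" "i1 + i2 = i" "j1 + j2 = j" "i1 * j2 - i2 * j1 = 1"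
      by blast
    have "i1 * j2 \<ge> 1" using s by (smt (verit) mult_nonneg_nonneg)
    then have ge: "i1 \<ge> 1" "j2 \<ge> 1" using s(1,4)
      by (smt (verit) mult_eq_0_iff)+
    define f where "f = (i1 * fst e + j1 * fst g, i1 * snd e + j1 * snd g)"
    define h where "h = (i2 * fst e + j2 * fst g, i2 * snd e + j2 * snd g)"
    have "det2 f h = (i1 * j2 - i2 * j1) * det2 e g" by (simp add: f_def h_def det2_def algebra_simps)
    then have det: "det2 f h = det2 e g" using s by simp
    have "ip f h = i1 * i2 * ip e e + (i1 * j2 + i2 * j1) * ip e g + j1 * j2 * ip g g"
      by (simp add: f_def h_def ip_def algebra_simps)
    then have ip: "ip f h \<ge> 0" using s a ip_self_nonneg[of e] ip_self_nonneg[of g] by simp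
    have sum: "a = f + h" using less.prems
      by (simp add: f_def h_def prod_eq_iff s(5,6)[symmetric] algebra_simps)
    have "parent a f"
    proof (cases "det2 f h = 1")
      case True
      then have "parents a f h" using ip sum by (simp add: parents_iff)
      then show ?thesis unfolding parent_def by blast
    next
      case False
      then have "det2 h f = 1" using det d det2_swap[of h f] by linarith
      moreover have "ip h f \<ge> 0" using ip by (simp add: ip_def mult.commute)
      ultimately have "parents a h f" using sum by (simp add: parents_iff add.commute)
      then show ?thesis unfolding parent_def by blast
    qed
    have "irreducible_vec f" using det d by (intro irreducible_vecI[of _ h]) simp
    \<comment> \<open>The determinant relation gives \<open>i1 * j = 1 + j1 * i\<close>, whence
      \<open>j f = e + j1 a\<close>. As \<open>j2 \<ge> 1\<close>, the weights satisfy
      \<open>1 + j1 \<le> j\<close>, so \<open>f\<close> lies in the triangle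
      \<open>0, e, a\<close>.\<close>
    moreover have "x + f \<in> X"
    proof (rule tri_mem[of x e a 1 j1 j])
      show "x + a \<in> X" using V_Vmax[OF x less.prems(1)] by (simp add: Vmax_def)
      have k: "i1 * j = 1 + j1 * i" using s(5-7) by (auto simp: algebra_simps)
      have "j * (i1 * c + j1 * c') = 1 * c + j1 * (i * c + j * c')" for c c'
      proof -
        have "j * (i1 * c + j1 * c') = (i1 * j) * c + j1 * (j * c')" by (simp add: algebra_simps)
        also have "\<dots> = 1 * c + j1 * (i * c + j * c')" unfolding k by (simp add: algebra_simps)
        finally show ?thesis .
      qed
      then show "j * fst f = 1 * fst e + j1 * fst a" "j * snd f = 1 * snd e + j1 * snd a"
        using less.prems by (simp_all add: f_def)
    qed (use x e s ge in \<open>auto simp: Vmax_def\<close>)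
    ultimately have "f \<in> Vmax X x" by (simp add: Vmax_def)
    then have "f \<in> V x" using stencils x less.prems(1) \<open>parent a f\<close> by (auto simp: stencils_def)
    then show ?thesis
      by (intro less.hyps[of j1 f i1]) (use s ge in \<open>auto simp: f_def\<close>)
  qed
qed

text \<open>Visibility provides an element of the stencil in the open half plane around \<open>e\<close>; it descends from \<open>e\<close>.\<close>

lemma unit_in_V:
  assumes x: "x \<in> X" and e: "e \<in> Vmax X x" and one: "ip e e = 1"
  shows "e \<in> V x"
proof -
  have lin: "linear (\<lambda>p. emb e \<bullet> p)" by (simp add: bounded_linear.linear bounded_linear_inner_right)
  have "Cone (V x) = Cone (Vmax X x)" using stencils x by (auto simp: stencils_def)
  from cone_functional_pos[OF e this lin] one obtain b where b: "b \<in> V x" "ip e b > 0"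
    by (auto simp: inner_emb)
  define j where "j = det2 e b"
  \<comment> \<open>The unit vector \<open>e\<close> turned by a right angle, towards the side on
    which \<open>b\<close> lies.\<close>
  define g :: point where "g = (if j \<ge> 0 then (- snd e, fst e) else (snd e, - fst e))"
  show ?thesis
  proof (rule ancestor_in_V[OF x e _ _ b(1), of g "ip e b" "\<bar>j\<bar>"])
    show "\<bar>det2 e g\<bar> = 1" using one by (auto simp: g_def det2_def ip_def)
    show "ip e g \<ge> 0" by (auto simp: g_def ip_def)
    have "fst b * ip e e = ip e b * fst e - det2 e b * snd e" "snd b * ip e e = ip e b * snd e + det2 e b * fst e"
      by (simp_all add: ip_def det2_def algebra_simps)
    then show "fst b = ip e b * fst e + \<bar>j\<bar> * fst g" "snd b = ip e b * snd e + \<bar>j\<bar> * snd g"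
      using one by (auto simp: g_def j_def)
  qed (use b in auto)
qed

text \<open>A stencil element strictly inside the cone of \<open>f\<close> and \<open>g\<close>
  would descend to \<open>e\<close>, so there is none. Visibility still provides elements with a
  positive coordinate along \<open>f\<close>, and others with a positive coordinate along
  \<open>g\<close>; these lie on or beyond the sides of that cone. Convexity of \<open>X\<close>
  then fills in \<open>f\<close> and \<open>g\<close>.\<close>

lemma parents_in_X:
  assumes x: "x \<in> X" and e: "e \<in> Vmax X x" "e \<notin> V x" and p: "parents e f g"
  shows "x + f \<in> X" "x + g \<in> X"
proof -
  have d: "det2 f g = 1" and i: "ip f g \<ge> 0" and ef: "e = f + g" using p by (simp_all add: parents_iff)
  have co: "fst a = det2 a g * fst f + det2 f a * fst g" "snd a = det2 a g * snd f + det2 f a * snd g" for a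
  proof -
    have "fst a * det2 f g = det2 a g * fst f + det2 f a * fst g"
     "snd a * det2 f g = det2 a g * snd f + det2 f a * snd g"
    by (simp_all add: det2_def algebra_simps)
    then show "fst a = det2 a g * fst f + det2 f a * fst g" "snd a = det2 a g * snd f + det2 f a * snd g" using d by simp_all
  qed
  have no: "det2 a g \<le> 0 \<or> det2 f a \<le> 0" if a: "a \<in> V x" for a
  proof (rule ccontr)
    assume n: "\<not> ?thesis"
    have "e \<in> V x"
    proof (cases "det2 a g \<ge> det2 f a")
      case True
      show ?thesis
      proof (rule ancestor_in_V[OF x e(1) _ _ a, of f "det2 f a" "det2 a g - det2 f a"])
        show "\<bar>det2 e f\<bar> = 1" using d by (simp add: ef det2_def algebra_simps)
        have "ip e f = ip f f + ip f g" by (simp add: ef ip_def algebra_simps)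
        then show "ip e f \<ge> 0" using i ip_self_nonneg[of f] by simp
      qed (use n True co[of a] in \<open>auto simp: ef algebra_simps\<close>)
    next
      case False
      show ?thesis
      proof (rule ancestor_in_V[OF x e(1) _ _ a, of g "det2 a g" "det2 f a - det2 a g"])
        show "\<bar>det2 e g\<bar> = 1" using d by (simp add: ef det2_def algebra_simps)
        have "ip e g = ip g g + ip f g" by (simp add: ef ip_def algebra_simps)
        then show "ip e g \<ge> 0" using i ip_self_nonneg[of g] by simp
      qed (use n False co[of a] in \<open>auto simp: ef algebra_simps\<close>)
    qed
    then show False using e by simp
  qed
  have cone: "Cone (V x) = Cone (Vmax X x)" using stencils x by (auto simp: stencils_def)
  have lin: "linear (\<lambda>p. (real_of_int c, real_of_int c') \<bullet> p)" for c c'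
    by (simp add: bounded_linear.linear bounded_linear_inner_right)
  have eX: "x + e \<in> X" using e by (simp add: Vmax_def)
  have de: "det2 e g = 1" "det2 f e = 1" using d by (simp_all add: ef det2_def algebra_simps)
  have *: "(real_of_int (snd g), real_of_int (- fst g)) \<bullet> emb a = of_int (det2 a g)"
     "(real_of_int (- snd f), real_of_int (fst f)) \<bullet> emb a = of_int (det2 f a)" for a
    by (simp_all add: emb_def det2_def)
  show "x + f \<in> X"
  proof -
    from cone_functional_pos[OF e(1) cone lin[of "snd g" "- fst g"]]
    obtain a where a: "a \<in> V x" "det2 a g > 0" unfolding * de by auto
    then have n: "det2 f a \<le> 0" using no[of a] by auto
    have "x + a \<in> X" using V_Vmax[OF x a(1)] by (simp add: Vmax_def)
    \<comment> \<open>With \<open>m = det2 a g > 0\<close> and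
      \<open>n = - det2 f a \<ge> 0\<close>, \<open>a = m f - n g\<close> and so
      \<open>(m + n) f = a + n e\<close>: the offset \<open>f\<close> lies in the triangle
      \<open>0, a, e\<close>.\<close>
    then show ?thesis
      by (intro tri_mem[of x a e 1 "- det2 f a" "det2 a g - det2 f a" f])
        (use x eX a n co[of a] in \<open>auto simp: ef algebra_simps\<close>)
  qed
  show "x + g \<in> X"
  proof -
    from cone_functional_pos[OF e(1) cone lin[of "- snd f" "fst f"]]
    obtain a where a: "a \<in> V x" "det2 f a > 0" unfolding * de by auto
    then have n: "det2 a g \<le> 0" using no[of a] by auto
    have "x + a \<in> X" using V_Vmax[OF x a(1)] by (simp add: Vmax_def)
    then show ?thesis
      by (intro tri_mem[of x a e 1 "- det2 a g" "det2 f a - det2 a g" g])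
        (use x eX a n co[of a] in \<open>auto simp: ef algebra_simps\<close>)
  qed
qed


text \<open>Induction on the length of \<open>e = f + g\<close>. If \<open>f\<close> is the longer parent, then \<open>f = f0 + g\<close> and
  \<open>P_form e f g x u = S_form g (x + f) u + P_form f f0 g x u\<close>; moreover \<open>S_form e\<close> is the sum of \<open>P_form e\<close>,
  \<open>P_form (- e)\<close>, \<open>S_form f\<close> and \<open>S_form g\<close>.\<close>

lemma S_P_nonneg:
  "(x \<in> X \<and> e \<in> Vmax X x \<and> x - e \<in> X \<longrightarrow> S_form e x u \<ge> 0) \<and>
   (\<forall>f g. x \<in> X \<and> e \<in> Vmax X x \<and> e \<notin> V x \<and> parents e f g \<longrightarrow> P_form e f g x u \<ge> 0)"
proof (induction "nat (ip e e)" arbitrary: e x rule: less_induct)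
  case less
  have S: "S_form h y u \<ge> 0" if "ip h h < ip e e" "y \<in> X" "irreducible_vec h" "y + h \<in> X" "y - h \<in> X" for h y
    using less.hyps[of h y] that ip_self_nonneg[of h] by (auto simp: Vmax_def)
  have P: "P_form h f g y u \<ge> 0" if "ip h h < ip e e" "y \<in> X" "y + h \<in> X" "h \<notin> V y" "parents h f g" for h f g y
  proof -
    have "nat (ip h h) < nat (ip e e)" using that(1) ip_self_nonneg[of h] by simp
    moreover have "h \<in> Vmax X y" using that parents_Vmax by blast
    ultimately show ?thesis using less.hyps[of h y] that by blast
  qed
  \<comment> \<open>Stated for every \<open>h\<close> as long as \<open>e\<close>, because the bound
    on \<open>S_form e\<close> also calls on \<open>P_form (- e)\<close>.\<close>
  have P_e: "P_form h f g x u \<ge> 0"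
    if h: "ip h h = ip e e" and x: "x \<in> X" and hX: "x + h \<in> X" and hV: "h \<notin> V x" and p: "parents h f g" for h f g
  proof -
    have d: "det2 f g = 1" and i: "ip f g \<ge> 0" and hf: "h = f + g" using p by (simp_all add: parents_iff)
    have hh: "ip h h = ip f f + ip g g + 2 * ip f g" by (simp add: hf ip_def algebra_simps)
    have pos: "ip f f \<ge> 1" "ip g g \<ge> 1" using det2_nonzero[of f g] d ip_self_pos by auto
    have short: "ip f f < ip e e" "ip g g < ip e e" using pos i h hh by auto
    have hVm: "h \<in> Vmax X x" using hX p parents_Vmax by blast
    have fg: "x + f \<in> X" "x + g \<in> X" using parents_in_X[OF x hVm hV p] .
    have irr: "irreducible_vec f" "irreducible_vec g"
      using d irreducible_vecI[of f g] irreducible_vecI[of g f] by (simp_all add: det2_def mult.commute)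
    have fgm: "f \<in> Vmax X x" "g \<in> Vmax X x" using fg irr by (simp_all add: Vmax_def)
    have stab: "b \<in> V x" if "a \<in> V x" "parents a b c \<or> parents a c b" "b \<in> Vmax X x" for a b c
      using stencils x that unfolding stencils_def parent_def by blast
    show ?thesis
    proof (cases "f \<in> V x \<and> g \<in> V x")
      case True
      then have "h \<in> candidates X V x" using hVm hV p unfolding candidates_def by blast
      then show ?thesis using u x p unfolding Conv_def by blast
    next
      case notboth: False
      consider "ip f f = ip g g" | "ip f f > ip g g" | "ip f f < ip g g" by linarith
      then show ?thesis
      proof cases
        \<comment> \<open>Parents of equal length are unit vectors, which always belong to the
          stencil.\<close>
        case 1
        then have "ip f f = 1" "ip g g = 1" using acute_same_length[OF d i] by simp_all
        then show ?thesis using notboth unit_in_V[OF x] fgm by blast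
      next
        case 2
        define f0 where "f0 = f - g"
        have "ip f0 g = ip f g - ip g g" by (simp add: f0_def ip_def algebra_simps)
        then have "ip f0 g \<ge> 0" using acute_longer[OF _ i 2] d by simp
        moreover have "det2 f0 g = 1" using d by (simp add: f0_def det2_def algebra_simps)
        ultimately have pf: "parents f f0 g" by (simp add: parents_iff f0_def)
        \<comment> \<open>The shorter parent \<open>g\<close> is itself a parent of
          \<open>f\<close>, so if \<open>f\<close> were in the stencil then so would be
          \<open>g\<close>, by Stability. Hence \<open>f\<close> is missing, and the induction
          hypothesis applies to its \<open>P_form\<close>.\<close>
        have fV: "f \<notin> V x" using notboth stab pf fgm by blast
        have f0: "x + f0 \<in> X" using parents_in_X[OF x fgm(1) fV pf] by simp
        have "P_form f f0 g x u \<ge> 0" using P[OF short(1) x fg(1) fV pf] .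
        moreover have "S_form g (x + f) u \<ge> 0"
          by (rule S[OF short(2) fg(1) irr(2)])
            (use hX f0 in \<open>simp_all add: hf f0_def algebra_simps\<close>)
        ultimately show ?thesis by (simp add: P_form_def S_form_def hf f0_def algebra_simps)
      next
        case 3
        define g0 where "g0 = g - f"
        have ac: "ip g f \<ge> ip f f"
          using acute_longer[of g f] d i 3 by (simp add: det2_def ip_def algebra_simps)
        then have pg: "parents g f g0" using d by (simp add: parents_iff g0_def ip_def det2_def algebra_simps)
        have gV: "g \<notin> V x" using notboth stab pg fgm by blast
        have g0: "x + g0 \<in> X" using parents_in_X[OF x fgm(2) gV pg] by simp
        have "P_form g f g0 x u \<ge> 0" using P[OF short(2) x fg(2) gV pg] .
        moreover have "S_form f (x + g) u \<ge> 0"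
          by (rule S[OF short(1) fg(2) irr(1)])
            (use hX g0 in \<open>simp_all add: hf g0_def algebra_simps\<close>)
        ultimately show ?thesis by (simp add: P_form_def S_form_def hf g0_def algebra_simps)
      qed
    qed
  qed
  have "S_form e x u \<ge> 0" if x: "x \<in> X" and e: "e \<in> Vmax X x" and me: "x - e \<in> X"
  proof (cases "e \<in> V x \<or> - e \<in> V x")
    case True
    then have "S_form e x u \<ge> 0 \<or> S_form (- e) x u \<ge> 0"
      using u x e me by (force simp: Conv_def Vmax_def)
    then show ?thesis by (auto simp: S_form_def)
  next
    case False
    have "ip e e \<noteq> 1" using unit_in_V[OF x e] False by blast
    moreover have "e \<noteq> 0" using e by (auto simp: Vmax_def irreducible_vec_def)
    ultimately have "ip e e > 1" using ip_self_pos[of e] by simp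
    then obtain f g where p: "parents e f g" using parents_exist[of e] e by (auto simp: Vmax_def)
    have d: "det2 f g = 1" and i: "ip f g \<ge> 0" and ef: "e = f + g" using p by (simp_all add: parents_iff)
    have pos: "ip f f \<ge> 1" "ip g g \<ge> 1" using det2_nonzero[of f g] d ip_self_pos by auto
    have ee: "ip e e = ip f f + ip g g + 2 * ip f g" by (simp add: ef ip_def algebra_simps)
    have short: "ip f f < ip e e" "ip g g < ip e e" using pos i ee by auto
    have irr: "irreducible_vec f" "irreducible_vec g"
      using d irreducible_vecI[of f g] irreducible_vecI[of g f] by (simp_all add: det2_def mult.commute)
    have mp: "parents (- e) (- f) (- g)" using d i ef by (simp add: parents_iff det2_def ip_def)
    have mem: "- e \<in> Vmax X x" using parents_Vmax[OF mp, of x X] me by simp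
    have fg: "x + f \<in> X" "x + g \<in> X" using parents_in_X[OF x e _ p] False by auto
    have mfg: "x - f \<in> X" "x - g \<in> X" using parents_in_X[OF x mem _ mp] False by auto
    have "P_form e f g x u \<ge> 0" using P_e[of e f g] x e False p by (auto simp: Vmax_def)
    moreover have "P_form (- e) (- f) (- g) x u \<ge> 0"
      using P_e[of "- e" "- f" "- g"] x me False mp by (auto simp: ip_def)
    moreover have "S_form f x u \<ge> 0" using S[OF short(1) x irr(1) fg(1) mfg(1)] .
    moreover have "S_form g x u \<ge> 0" using S[OF short(2) x irr(2) fg(2) mfg(2)] .
    ultimately show ?thesis by (simp add: P_form_def S_form_def)
  qed
  then show ?case using P_e[of e] by (auto simp: Vmax_def)
qed

lemma S_nonneg:
  "x \<in> X \<Longrightarrow> irreducible_vec e \<Longrightarrow> x + e \<in> X \<Longrightarrow> x - e \<in> X \<Longrightarrow> S_form e x u \<ge> 0"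
  using S_P_nonneg[of x e] by (auto simp: Vmax_def)

text \<open>The accounting principle: an edge created by a strict improvement is charged to an
  element of the stencil.\<close>

lemma P_neg_in_V:
  assumes "x \<in> X" "x + e \<in> X" "parents e f g" "P_form e f g x u < 0"
  shows "e \<in> V x"
proof (rule ccontr)
  assume "e \<notin> V x"
  moreover have "e \<in> Vmax X x" using assms parents_Vmax by blast
  ultimately have "P_form e f g x u \<ge> 0" using S_P_nonneg[of x e] assms by blast
  then show False using assms by simp
qed

text \<open>Outside the stencil, \<open>T_form e f g\<close> is the sum of
  \<open>P_form e f g\<close>, \<open>S_form f\<close> and \<open>S_form g\<close>, whose points
  \<open>x + f\<close> and \<open>x + g\<close> are available by
  \<open>parents_in_X\<close>.\<close>

lemma T_nonneg:
  assumes x: "x \<in> X" and p: "parents e f g" and X: "x + e \<in> X" "x - f \<in> X" "x - g \<in> X"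
  shows "T_form e f g x u \<ge> 0"
proof (cases "e \<in> V x")
  case True
  moreover have "{x + e, x - f, x - g, x} \<subseteq> X" using x X by simp
  ultimately show ?thesis using u x p unfolding Conv_def by blast
next
  case False
  have d: "det2 f g = 1" using p by (simp add: parents_iff)
  have irr: "irreducible_vec f" "irreducible_vec g"
    using d irreducible_vecI[of f g] irreducible_vecI[of g f] by (simp_all add: det2_def mult.commute)
  have e: "e \<in> Vmax X x" using X p parents_Vmax by blast
  have fg: "x + f \<in> X" "x + g \<in> X" using parents_in_X[OF x e False p] .
  have "P_form e f g x u \<ge> 0" using P_neg_in_V[OF x X(1) p] False by fastforce
  moreover have "S_form f x u \<ge> 0" "S_form g x u \<ge> 0" using S_nonneg irr fg X x by auto
  ultimately show ?thesis by (simp add: P_form_def S_form_def T_form_def)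
qed

text \<open>By the identity \<open>\<bar>det2 a b\<bar>\<^sup>2 = p * q + q * r + r * p\<close> for the opposites \<open>p, q, r\<close> of the three scalar products,
  these cannot all be negative; hence two of the vectors are, up to sign, parents of the third one.\<close>

lemma superbase_convex:
  assumes x: "x \<in> X" and d: "\<bar>det2 a b\<bar> = 1" and s: "a + b + c = 0"
    and X: "x + a \<in> X" "x + b \<in> X" "x + c \<in> X"
  shows "u (x + a) + u (x + b) + u (x + c) \<ge> 3 * u x"
proof -
  have T: "u (x + a) + u (x + b) + u (x + c) \<ge> 3 * u x"
    if "\<bar>det2 a b\<bar> = 1" "a + b + c = 0" "ip a b \<ge> 0"
     "x + a \<in> X" "x + b \<in> X" "x + c \<in> X" for a b c
  proof -
    have c: "c = - a - b" using that(2) by (simp add: prod_eq_iff)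
    show ?thesis
    proof (cases "det2 a b = 1")
      case True
      then have "parents c (- a) (- b)" using that c by (simp add: parents_iff det2_def ip_def)
      from T_nonneg[OF x this] show ?thesis using that by (simp add: T_form_def)
    next
      case False
      then have "det2 b a = 1" using that(1) by (simp add: det2_def algebra_simps)
      then have "parents c (- b) (- a)" using that c by (simp add: parents_iff det2_def ip_def algebra_simps)
      from T_nonneg[OF x this] show ?thesis using that by (simp add: T_form_def)
    qed
  qed
  have c: "c = - a - b" using s by (simp add: prod_eq_iff)
  have d': "\<bar>det2 b c\<bar> = 1" "\<bar>det2 c a\<bar> = 1" using d by (simp_all add: c det2_def algebra_simps abs_minus_commute)
  consider "ip a b \<ge> 0" | "ip b c \<ge> 0" | "ip c a \<ge> 0" | "ip a b < 0" "ip b c < 0" "ip c a < 0" by linarith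
  then show ?thesis
  proof cases
    case 1 then show ?thesis using T[of a b c] d s X by simp
  next
    case 2 then show ?thesis using T[of b c a] d' s X by (simp add: algebra_simps)
  next
    case 3 then show ?thesis using T[of c a b] d' s X by (simp add: algebra_simps)
  next
    case 4
    define p q r where "p = - ip a b" and "q = - ip b c" and "r = - ip c a"
    have 1: "p \<ge> 1" "q \<ge> 1" "r \<ge> 1" using 4 by (simp_all add: p_def q_def r_def)
    have "ip a a = p + r" "ip b b = p + q" by (simp_all add: p_def q_def r_def c ip_def algebra_simps)
    then have "(p + r) * (p + q) = p\<^sup>2 + (det2 a b)\<^sup>2" using lagrange_identity[of a b] by (simp add: p_def)
    moreover have "(det2 a b)\<^sup>2 = 1" using d by (metis one_power2 power2_abs)
    ultimately have "p * q + r * p + r * q = 1" by (simp add: algebra_simps power2_eq_square)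
    moreover have "p * q \<ge> 1" "r * p \<ge> 1" "r * q \<ge> 1" using 1 mult_mono[of 1 _ 1] by force+
    ultimately show ?thesis by simp
  qed
qed

text \<open>Here \<open>a + b = - m c\<close>. The cases \<open>m = 0\<close> and
  \<open>m = 1\<close> are a second difference and a superbase. For \<open>m \<ge> 2\<close>, the
  point \<open>x - c\<close> lies in the triangle \<open>x, x + a, x + b\<close>, and seen from
  there the parameter is \<open>m - 2\<close>; adding \<open>m\<close> times
  \<open>S_form c x u\<close> returns to \<open>x\<close>.\<close>

lemma local_convex:
  assumes "x \<in> X" "x + a \<in> X" "x + c \<in> X" "x + b \<in> X" "\<bar>det2 c a\<bar> = 1" 
    and "fst b = - fst a - int m * fst c" "snd b = - snd a - int m * snd c"
  shows "u (x + a) + u (x + b) + real m * u (x + c) \<ge> (real m + 2) * u x"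
  using assms
proof (induction m arbitrary: x a b rule: less_induct)
  case (less m)
  have irr: "irreducible_vec a" "irreducible_vec c"
    using less.prems(5) irreducible_vecI[of c a] irreducible_vecI[of a c]
    by (simp_all add: det2_def algebra_simps abs_minus_commute)
  consider "m = 0" | "m = 1" | "m \<ge> 2" by linarith
  then show ?case
  proof cases
    case 1
    then have "b = - a" using less.prems by (simp add: prod_eq_iff)
    then show ?thesis using S_nonneg[OF _ irr(1), of x] less.prems 1 by (simp add: S_form_def)
  next
    case 2
    then have b: "b = - a - c" using less.prems by (simp add: prod_eq_iff)
    then have "a + b + c = 0" by simp
    moreover have "\<bar>det2 a b\<bar> = 1" using less.prems(5) by (simp add: b det2_def algebra_simps)
    ultimately show ?thesis using superbase_convex[of x a b c] less.prems 2 by simp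
  next
    case 3
    have xc: "x + (- c) \<in> X"
      by (rule tri_mem[of x a b 1 1 "int m"]) (use 3 less.prems in auto)
    have "u ((x - c) + (a + c)) + u ((x - c) + (b + c)) + real (m - 2) * u (x - c + c) \<ge> (real (m - 2) + 2) * u (x - c)"
      by (rule less.IH) (use 3 less.prems xc in \<open>auto simp: algebra_simps det2_def\<close>)
    then have 1: "u (x + a) + u (x + b) + (real m - 2) * u x \<ge> real m * u (x - c)"
      using 3 by (simp add: algebra_simps)
    have "S_form c x u \<ge> 0" using S_nonneg[OF less.prems(1) irr(2)] less.prems xc by simp
    then have "real m * (u (x - c) + u (x + c) - 2 * u x) \<ge> 0" by (simp add: S_form_def)
    then show ?thesis using 1 by (simp add: algebra_simps)
  qed
qed

end

section \<open>Barycentric weights and unimodular triangulations\<close>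

text \<open>The weights are functions on all of the grid that vanish outside \<open>s\<close>, so
  weights for different triangles can be compared by equality.\<close>

definition bary :: "point set \<Rightarrow> point set \<Rightarrow> (point \<Rightarrow> real) \<Rightarrow> real \<times> real \<Rightarrow> bool" where
  "bary X s w p \<longleftrightarrow> (\<forall>v. 0 \<le> w v) \<and> (\<forall>v. v \<notin> s \<longrightarrow> w v = 0) \<and>
     sum w X = 1 \<and> (\<Sum>v\<in>X. w v *\<^sub>R emb v) = p"

definition unimodular :: "point set \<Rightarrow> bool" where
  "unimodular s \<longleftrightarrow> card s = 3 \<and> (\<forall>a b c. s = {a, b, c} \<longrightarrow> \<bar>det2 (b - a) (c - a)\<bar> = 1)"

lemma sum_supp:
  fixes h :: "point \<Rightarrow> 'b::real_vector"
  assumes "finite X" "s \<subseteq> X" "\<And>v. v \<notin> s \<Longrightarrow> w v = 0"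
  shows "(\<Sum>v\<in>X. w v *\<^sub>R h v) = (\<Sum>v\<in>s. w v *\<^sub>R h v)"
  using assms by (intro sum.mono_neutral_right) auto

lemma bary_sub: "bary X s w p \<Longrightarrow> s \<subseteq> s' \<Longrightarrow> bary X s' w p"
  unfolding bary_def by blast

lemma bary_restrict:
  assumes X: "finite X" "s \<subseteq> X" and w: "\<forall>v\<in>s. 0 \<le> w v" "sum w s = 1" "(\<Sum>v\<in>s. w v *\<^sub>R emb v) = p"
  shows "bary X s (\<lambda>v. if v \<in> s then w v else 0) p"
proof -
  have i: "X \<inter> s = s" using X by auto
  have "(\<Sum>v\<in>X. (if v \<in> s then w v else 0) *\<^sub>R emb v) = (\<Sum>v\<in>s. w v *\<^sub>R emb v)"
    using X by (subst sum_supp[of X s]) auto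
  moreover have "(\<Sum>v\<in>X. if v \<in> s then w v else 0) = sum w s"
    using X by (simp add: sum.inter_restrict[symmetric] i)
  ultimately show ?thesis using w by (simp add: bary_def)
qed

lemma baryD:
  assumes X: "finite X" "s \<subseteq> X" and b: "bary X s w p"
  shows "\<forall>v\<in>s. 0 \<le> w v" "sum w s = 1" "(\<Sum>v\<in>s. w v *\<^sub>R emb v) = p"
proof -
  show "\<forall>v\<in>s. 0 \<le> w v" using b unfolding bary_def by blast
  have "\<And>v. v \<notin> s \<Longrightarrow> w v = 0" "(\<Sum>v\<in>X. w v *\<^sub>R emb v) = p" using b unfolding bary_def by blast+
  then show "(\<Sum>v\<in>s. w v *\<^sub>R emb v) = p" using sum_supp[OF X, of w emb] by simp
  have "sum w X = sum w s" using b X unfolding bary_def by (intro sum.mono_neutral_right) auto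
  then show "sum w s = 1" using b by (simp add: bary_def)
qed

lemma Hull_iff_bary:
  assumes X: "finite X" "s \<subseteq> X"
  shows "p \<in> Hull s \<longleftrightarrow> (\<exists>w. bary X s w p)"
proof -
  have fin: "finite s" using X finite_subset by blast
  have inj: "inj_on emb s" using inj_emb inj_on_subset by blast
  show ?thesis
  proof
    assume "p \<in> Hull s"
    then obtain w where "\<forall>x\<in>emb ` s. 0 \<le> w x" "sum w (emb ` s) = 1" "(\<Sum>x\<in>emb ` s. w x *\<^sub>R x) = p"
      using fin by (auto simp: Hull_def convex_hull_finite)
    then have "bary X s (\<lambda>v. if v \<in> s then (w \<circ> emb) v else 0) p"
      by (intro bary_restrict[OF X]) (auto simp: sum.reindex[OF inj])
    then show "\<exists>w. bary X s w p" by blast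
  next
    assume "\<exists>w. bary X s w p"
    then obtain w where "bary X s w p" by blast
    note w = baryD[OF X this]
    have "(\<Sum>v\<in>s. w v *\<^sub>R emb v) \<in> convex hull (emb ` s)"
      using w by (intro convex_sum[OF fin convex_convex_hull]) (auto intro: hull_inc)
    then show "p \<in> Hull s" using w by (simp add: Hull_def)
  qed
qed

lemma bary_vertex:
  assumes "finite X" "s \<subseteq> X" "v \<in> s"
  shows "bary X s (\<lambda>z. if z = v then 1 else 0) (emb v)"
proof -
  have v: "v \<in> X" using assms by auto
  have "(\<Sum>z\<in>X. (if z = v then 1 else 0) *\<^sub>R emb z) = (\<Sum>z\<in>X. if z = v then emb z else 0)"
    by (intro sum.cong) auto
  then show ?thesis using assms v by (auto simp: bary_def)
qed

lemma bary_affine_unique: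
  assumes X: "finite X" "s \<subseteq> X" and ind: "\<not> affine_dependent (emb ` s)"
    and b: "bary X s w p" "bary X s w' p"
  shows "w = w'"
proof (rule ccontr)
  assume "w \<noteq> w'"
  then obtain v where v: "w v \<noteq> w' v" by blast
  then have vs: "v \<in> s" using b by (metis bary_def)
  have fin: "finite s" using X finite_subset by blast
  have inj: "inj_on emb s" using inj_emb inj_on_subset by blast
  define U where "U z = w (inv emb z) - w' (inv emb z)" for z
  have U: "U (emb z) = w z - w' z" for z by (simp add: U_def inv_f_f[OF inj_emb])
  note w = baryD[OF X b(1)] and w' = baryD[OF X b(2)]
  have "sum U (emb ` s) = 0" using w w' by (simp add: sum.reindex[OF inj] U sum_subtractf)
  moreover have "(\<Sum>z\<in>emb ` s. U z *\<^sub>R z) = 0"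
    using w w' by (simp add: sum.reindex[OF inj] U sum_subtractf algebra_simps)
  moreover have "\<exists>z\<in>emb ` s. U z \<noteq> 0" using vs v by (intro bexI[of _ "emb v"]) (auto simp: U)
  ultimately have "affine_dependent (emb ` s)"
    using fin by (subst affine_dependent_explicit_finite) auto
  then show False using ind by simp
qed

section \<open>Determinants of lattice triangles\<close>

lemma affine_dependent_iff_det2:
  assumes "card {a, b, c} = 3"
  shows "affine_dependent (emb ` {a, b, c}) \<longleftrightarrow> det2 (b - a) (c - a) = 0"
proof -
  have ne: "a \<noteq> b" "a \<noteq> c" "b \<noteq> c" using assms by (auto simp: card_insert_if split: if_splits)
  have "affine_dependent (emb ` {a, b, c}) \<longleftrightarrow> collinear {emb b, emb a, emb c}"
  proof -
    have "collinear {emb b, emb a, emb c} \<longleftrightarrow>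
        emb b = emb a \<or> emb b = emb c \<or> emb a = emb c \<or> affine_dependent {emb b, emb a, emb c}"
      by (rule collinear_3_eq_affine_dependent)
    moreover have "emb ` {a, b, c} = {emb b, emb a, emb c}" by auto
    ultimately show ?thesis using ne emb_eq_iff[of b a] emb_eq_iff[of b c] emb_eq_iff[of a c]
      by (simp only:) blast
  qed
  also have "\<dots> \<longleftrightarrow> collinear {0, emb b - emb a, emb c - emb a}"
    by (rule collinear_3) simp
  also have "\<dots> \<longleftrightarrow> (\<exists>k. emb (c - a) = k *\<^sub>R emb (b - a))"
    using ne by (simp add: collinear_lemma emb_eq_iff emb_diff)
  also have "\<dots> \<longleftrightarrow> det2 (b - a) (c - a) = 0"
  proof
    assume "\<exists>k. emb (c - a) = k *\<^sub>R emb (b - a)"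
    then obtain k where "emb (c - a) = k *\<^sub>R emb (b - a)" by blast
    then have "real_of_int (fst (c - a)) = k * fst (b - a)" "real_of_int (snd (c - a)) = k * snd (b - a)"
      by (simp_all add: emb_def del: fst_diff snd_diff)
    then have "real_of_int (det2 (b - a) (c - a)) = 0" by (simp add: det2_def del: fst_diff snd_diff)
    then show "det2 (b - a) (c - a) = 0" by linarith
  next
    assume d: "det2 (b - a) (c - a) = 0"
    obtain f where f: "f = b - a" by simp
    obtain g where g: "g = c - a" by simp
    have "real_of_int (det2 f g) = 0" using d f g by simp
    then have eq: "real_of_int (fst f) * snd g = snd f * fst g" by (simp add: det2_def)
    have "f \<noteq> 0" using ne f by auto
    then consider "fst f \<noteq> 0" | "snd f \<noteq> 0" by (auto simp: prod_eq_iff)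
    then have "\<exists>k. emb g = k *\<^sub>R emb f"
    proof cases
      case 1
      then show ?thesis using eq by (intro exI[of _ "fst g / fst f"]) (simp add: emb_def field_simps)
    next
      case 2
      then show ?thesis using eq by (intro exI[of _ "snd g / snd f"]) (simp add: emb_def field_simps)
    qed
    then show "\<exists>k. emb (c - a) = k *\<^sub>R emb (b - a)" using f g by simp
  qed
  finally show ?thesis .
qed

text \<open>Otherwise some lattice point is not an integer combination of \<open>f\<close> and \<open>g\<close>. Reduce it to the fundamental
  parallelogram, and then, by central symmetry, to one half of it.\<close>

lemma empty_triangle_unimodular:
  assumes d: "det2 f g \<noteq> 0"
    and empty: "\<And>h. emb (a + h) \<in> Hull {a, a + f, a + g} \<Longrightarrow> h \<in> {0, f, g}"
  shows "\<bar>det2 f g\<bar> = 1"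
proof -
  have pos: "det2 f g = 1" if d: "det2 f g > 0"
    and empty: "\<And>h. emb (a + h) \<in> Hull {a, a + f, a + g} \<Longrightarrow> h \<in> {0, f, g}" for f g
  proof -
    define D where "D = det2 f g"
    have co: "D * fst h = det2 h g * fst f + det2 f h * fst g" "D * snd h = det2 h g * snd f + det2 f h * snd g" for h
      by (simp_all add: D_def det2_def algebra_simps)
    have D: "D > 0" using d D_def by simp
    have z: "det2 f f = 0" "det2 g g = 0" "det2 0 g = 0" "det2 f 0 = 0" by (simp_all add: det2_def)
    have inner: False if h: "det2 h g \<ge> 0" "det2 f h \<ge> 0" "det2 h g + det2 f h \<le> D" "det2 h g < D" "det2 f h < D" "h \<noteq> 0" for h
    proof -
      have "emb (a + h) \<in> Hull {a, a + f, a + g}"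
        by (rule tri_hull_mem[of _ _ f g "det2 h g" "det2 f h" D]) (use h D co[of h] in auto)
      then have "h \<in> {0, f, g}" by (rule empty)
      then show False using h z by (auto simp: D_def)
    qed
    have dvd: "D dvd det2 h g \<and> D dvd det2 f h" for h
    proof (rule ccontr)
      assume n: "\<not> ?thesis"
      define m n where "m = det2 h g mod D" and "n = det2 f h mod D"
      define h' where "h' = (fst h - (det2 h g div D) * fst f - (det2 f h div D) * fst g,
        snd h - (det2 h g div D) * snd f - (det2 f h div D) * snd g)"
      have "det2 h' g = det2 h g - (det2 h g div D) * D" "det2 f h' = det2 f h - (det2 f h div D) * D"
        by (simp_all add: h'_def det2_def D_def algebra_simps)
      then have h': "det2 h' g = m" "det2 f h' = n" by (simp_all add: m_def n_def minus_div_mult_eq_mod)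
      have mn: "0 \<le> m" "m < D" "0 \<le> n" "n < D" using D by (simp_all add: m_def n_def)
      have mn0: "m \<noteq> 0 \<or> n \<noteq> 0" using n by (auto simp: m_def n_def mod_eq_0_iff_dvd)
      have "h' \<noteq> 0" using mn0 h' z by auto
      then have big: "m + n > D" using inner[of h'] h' mn by force
      have h'': "det2 (f + g - h') g = D - m" "det2 f (f + g - h') = D - n"
        using h' by (simp_all add: det2_def D_def algebra_simps)
      have "f + g - h' \<noteq> 0"
      proof
        assume "f + g - h' = 0"
        then have "D - m = 0" using h''(1) z by simp
        then show False using mn by simp
      qed
      then show False using inner[of "f + g - h'"] h'' mn big by force
    qed
    \<comment> \<open>For the two unit vectors the divisibilities say that \<open>D\<close> divides
      all four entries of \<open>f\<close> and \<open>g\<close>, hence \<open>D * D\<close> divides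
      their determinant \<open>D\<close>.\<close>
    have "D dvd snd g" "D dvd snd f" "D dvd fst g" "D dvd fst f"
      using dvd[of "(1, 0)"] dvd[of "(0, 1)"] by (simp_all add: det2_def)
    then have "D * D dvd fst f * snd g - snd f * fst g" by (intro dvd_diff mult_dvd_mono)
    then have "D * D dvd D * 1" by (simp add: D_def det2_def)
    then have "D dvd 1" using D by (simp only: dvd_mult_cancel_left) simp
    then show ?thesis using D D_def by simp
  qed
  show ?thesis
  proof (cases "det2 f g > 0")
    case True
    then show ?thesis using pos[of f g] empty by simp
  next
    case False
    then have "det2 g f > 0" using d det2_swap[of g f] by simp
    moreover have "h \<in> {0, g, f}" if "emb (a + h) \<in> Hull {a, a + g, a + f}" for h
      using empty[of h] that by (auto simp: insert_commute)
    ultimately have "det2 g f = 1" using pos[of g f] by blast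
    then show ?thesis using det2_swap[of g f] by simp
  qed
qed

lemma bary_nonneg: "bary X s w p \<Longrightarrow> 0 \<le> w v"
  unfolding bary_def by (elim conjE allE)

lemma bary_zero: "bary X s w p \<Longrightarrow> v \<notin> s \<Longrightarrow> w v = 0"
  unfolding bary_def by (elim conjE) (drule spec, erule mp)

lemma bary_Int:
  assumes "bary X s w p" "bary X s' w p" shows "bary X (s \<inter> s') w p"
proof -
  have "\<forall>v. v \<notin> s \<inter> s' \<longrightarrow> w v = 0" using bary_zero[OF assms(1)] bary_zero[OF assms(2)] by blast
  then show ?thesis using assms(1) unfolding bary_def by (elim conjE) (intro conjI)
qed

text \<open>Intersections along common faces amount to the uniqueness of barycentric weights across all triangles.\<close>

definition tri :: "point set \<Rightarrow> point set set \<Rightarrow> bool" where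
  "tri X \<T> \<longleftrightarrow> (\<forall>s\<in>\<T>. s \<subseteq> X \<and> unimodular s) \<and>
     (\<forall>s\<in>\<T>. \<forall>s'\<in>\<T>. \<forall>w w' p. bary X s w p \<longrightarrow> bary X s' w' p \<longrightarrow> w = w') \<and>
     (\<forall>p\<in>Hull X. \<exists>s\<in>\<T>. \<exists>w. bary X s w p) \<and> \<Union> \<T> = X"

lemma tri_subset: "tri X \<T> \<Longrightarrow> s \<in> \<T> \<Longrightarrow> s \<subseteq> X"
  and tri_unimodular: "tri X \<T> \<Longrightarrow> s \<in> \<T> \<Longrightarrow> unimodular s"
  and tri_cover: "tri X \<T> \<Longrightarrow> p \<in> Hull X \<Longrightarrow> \<exists>s\<in>\<T>. \<exists>w. bary X s w p"
  and tri_Union: "tri X \<T> \<Longrightarrow> \<Union> \<T> = X"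
  by (simp_all add: tri_def)

lemma tri_conform:
  assumes "tri X \<T>" "s \<in> \<T>" "s' \<in> \<T>" "bary X s w p" "bary X s' w' p"
  shows "w = w'"
proof -
  have "\<forall>s\<in>\<T>. \<forall>s'\<in>\<T>. \<forall>w w' p. bary X s w p \<longrightarrow> bary X s' w' p \<longrightarrow> w = w'"
    using assms(1) unfolding tri_def by (elim conjE)
  then show ?thesis using assms(2-) by blast
qed

lemma unimodular_card: "unimodular s \<Longrightarrow> card s = 3"
  by (simp only: unimodular_def)

lemma unimodular_det2: "unimodular {a, b, c} \<Longrightarrow> \<bar>det2 (b - a) (c - a)\<bar> = 1"
  unfolding unimodular_def by (elim conjE allE) (erule mp, rule refl)

lemma unimodular_affine_independent:
  assumes "unimodular s" shows "\<not> affine_dependent (emb ` s)"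
proof -
  obtain a b c where s: "s = {a, b, c}" using assms unfolding unimodular_def card_3_iff by blast
  moreover have "card s = 3" "\<bar>det2 (b - a) (c - a)\<bar> = 1" using assms s unfolding unimodular_def by blast+
  ultimately show ?thesis using affine_dependent_iff_det2[of a b c] by fastforce
qed

context lattice_polygon begin

text \<open>The intersection of two triangles is a face of both. Its extreme points are therefore
  vertices of both, so each of its points has weights supported on common vertices. Since all of
  \<open>X\<close> are vertices, a lattice point in a triangle must be one of its corners, and empty
  lattice triangles are unimodular.\<close>

lemma triangulation_tri:
  assumes T: "is_triangulation X \<T>" shows "tri X \<T>"
proof -
  have ind: "card s = 3" "\<not> affine_dependent (emb ` s)" if "s \<in> \<T>" for s
    using T that unfolding is_triangulation_def by blast+
  have face: "(Hull s \<inter> Hull s') face_of Hull s" if "s \<in> \<T>" "s' \<in> \<T>" for s s'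
    using T that unfolding is_triangulation_def triangulation_def by blast
  have cover: "\<Union> (Hull ` \<T>) = Hull X" and UX: "\<Union> \<T> = X" using T unfolding is_triangulation_def by blast+
  have sX: "s \<subseteq> X" if "s \<in> \<T>" for s using UX that by blast
  have conf: "w = w'" if s: "s \<in> \<T>" "s' \<in> \<T>" and b: "bary X s w p" "bary X s' w' p" for s s' w w' p
  proof -
    let ?F = "Hull s \<inter> Hull s'"
    have "?F face_of Hull s'" using face[OF s(2,1)] by (simp add: Int_commute)
    then obtain c' where c': "c' \<subseteq> emb ` s'" "?F = convex hull c'"
      using face_of_convex_hull_affine_independent[OF ind(2)[OF s(2)], of ?F] unfolding Hull_def by blast
    obtain c where c: "c \<subseteq> emb ` s" "?F = convex hull c"
      using face[OF s] face_of_convex_hull_affine_independent[OF ind(2)[OF s(1)], of ?F] unfolding Hull_def by blast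
    have i: "\<not> affine_dependent c" "\<not> affine_dependent c'"
      using affine_independent_subset[OF ind(2)[OF s(1)] c(1)]
        affine_independent_subset[OF ind(2)[OF s(2)] c'(1)] .
    have "c = {x. x extreme_point_of ?F}"
      unfolding c(2) using extreme_point_of_convex_hull_affine_independent[OF i(1)] by blast
    also have "\<dots> = c'"
      unfolding c'(2) using extreme_point_of_convex_hull_affine_independent[OF i(2)] by blast
    finally have "c \<subseteq> emb ` s \<inter> emb ` s'" using c c' by blast
    then have "c \<subseteq> emb ` (s \<inter> s')" by (simp add: image_Int[OF inj_emb])
    then have "?F \<subseteq> Hull (s \<inter> s')" unfolding c(2) unfolding Hull_def by (rule hull_mono)
    moreover have "p \<in> ?F"
      using b Hull_iff_bary[OF finite_X sX[OF s(1)]] Hull_iff_bary[OF finite_X sX[OF s(2)]] by blast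
    ultimately have "p \<in> Hull (s \<inter> s')" by blast
    then obtain w1 where "bary X (s \<inter> s') w1 p" using Hull_iff_bary[OF finite_X, of "s \<inter> s'"] sX[OF s(1)] by blast
    then have "bary X s w1 p" "bary X s' w1 p" by (auto elim: bary_sub)
    then have "w = w1" "w' = w1"
      using b bary_affine_unique[OF finite_X sX[OF s(1)] ind(2)[OF s(1)]]
        bary_affine_unique[OF finite_X sX[OF s(2)] ind(2)[OF s(2)]] by blast+
    then show ?thesis by simp
  qed
  have empty: "v \<in> s" if s: "s \<in> \<T>" and v: "emb v \<in> Hull s" for s v
  proof -
    have "Hull s \<subseteq> Hull X" unfolding Hull_def by (intro hull_mono image_mono sX[OF s])
    then have "emb v \<in> Hull X" using v by blast
    then have "v \<in> X" by (rule lattice_convex)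
    then obtain s' where s': "s' \<in> \<T>" "v \<in> s'" using UX by blast
    obtain w where w: "bary X s w (emb v)" using v Hull_iff_bary[OF finite_X sX[OF s]] by blast
    have "w = (\<lambda>z. if z = v then 1 else 0)"
      using conf[OF s s'(1) w bary_vertex[OF finite_X sX[OF s'(1)] s'(2)]] .
    then have "w v \<noteq> 0" by simp
    then show ?thesis using w unfolding bary_def by blast
  qed
  have uni: "unimodular s" if s: "s \<in> \<T>" for s
    unfolding unimodular_def
  proof (intro conjI allI impI)
    show "card s = 3" using ind s by blast
    fix a b c assume abc: "s = {a, b, c}"
    show "\<bar>det2 (b - a) (c - a)\<bar> = 1"
    proof (rule empty_triangle_unimodular)
      show "det2 (b - a) (c - a) \<noteq> 0" using ind[OF s] affine_dependent_iff_det2[of a b c] abc by simp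
      fix h assume "emb (a + h) \<in> Hull {a, a + (b - a), a + (c - a)}"
      then have "emb (a + h) \<in> Hull s" by (simp add: abc)
      then have "a + h \<in> s" by (rule empty[OF s])
      then show "h \<in> {0, b - a, c - a}" by (auto simp: abc)
    qed
  qed
  have "\<exists>s\<in>\<T>. \<exists>w. bary X s w p" if "p \<in> Hull X" for p
  proof -
    obtain s where s: "s \<in> \<T>" "p \<in> Hull s" using \<open>p \<in> Hull X\<close> cover by blast
    then show ?thesis using Hull_iff_bary[OF finite_X sX[OF s(1)]] by blast
  qed
  moreover have "\<forall>s\<in>\<T>. s \<subseteq> X \<and> unimodular s" using sX uni by simp
  moreover have "\<forall>s\<in>\<T>. \<forall>s'\<in>\<T>. \<forall>w w' p. bary X s w p \<longrightarrow> bary X s' w' p \<longrightarrow> w = w'"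
    by (intro ballI allI impI) (rule conf)
  ultimately show ?thesis using UX by (simp add: tri_def)
qed

text \<open>A point of two triangles has one weight function, supported on the common vertices. So
  the intersection is the hull of these, which is a face.\<close>

lemma tri_triangulation:
  assumes T: "tri X \<T>" shows "is_triangulation X \<T>"
proof -
  have sX: "s \<subseteq> X" and uni: "unimodular s" if "s \<in> \<T>" for s using T that by (simp_all add: tri_def)
  have "\<T> \<subseteq> Pow X" using sX by blast
  then have fin: "finite \<T>" using finite_X by (metis finite_Pow_iff finite_subset)
  have ind: "card s = 3" "\<not> affine_dependent (emb ` s)" if "s \<in> \<T>" for s
    using unimodular_card unimodular_affine_independent uni[OF that] by blast+
  have "2 simplex Hull s" if s: "s \<in> \<T>" for s
  proof -
    have "card (emb ` s) = 3" using ind[OF s] card_image[OF inj_on_subset[OF inj_emb]] by simp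
    then show ?thesis unfolding simplex_def Hull_def using ind[OF s] by (intro exI[of _ "emb ` s"]) auto
  qed
  moreover have "(Hull s \<inter> Hull s') face_of Hull s" if s: "s \<in> \<T>" "s' \<in> \<T>" for s s'
  proof -
    have "Hull s \<inter> Hull s' \<subseteq> Hull (s \<inter> s')"
    proof
      fix p assume "p \<in> Hull s \<inter> Hull s'"
      then obtain w w' where w: "bary X s w p" "bary X s' w' p"
        using Hull_iff_bary[OF finite_X sX[OF s(1)], of p] Hull_iff_bary[OF finite_X sX[OF s(2)], of p] by auto
      then have "w = w'" using tri_conform[OF T s] by blast
      then have "bary X s' w p" using w by simp
      then have "bary X (s \<inter> s') w p" using w(1) by (rule bary_Int[rotated])
      then show "p \<in> Hull (s \<inter> s')" using Hull_iff_bary[OF finite_X, of "s \<inter> s'"] sX[OF s(1)] by blast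
    qed
    moreover have "Hull (s \<inter> s') \<subseteq> Hull s \<inter> Hull s'" unfolding Hull_def by (intro Int_greatest hull_mono) auto
    ultimately have "Hull s \<inter> Hull s' = Hull (s \<inter> s')" by (rule subset_antisym)
    moreover have "convex hull (emb ` (s \<inter> s')) face_of convex hull (emb ` s)"
      unfolding face_of_convex_hull_affine_independent[OF ind(2)[OF s(1)]]
      by (intro exI[of _ "emb ` (s \<inter> s')"] conjI image_mono Int_lower1 refl)
    ultimately show ?thesis by (simp only: Hull_def)
  qed
  ultimately have "triangulation (Hull ` \<T>)" using fin unfolding triangulation_def by blast
  moreover have "\<Union> (Hull ` \<T>) = Hull X"
  proof
    show "\<Union> (Hull ` \<T>) \<subseteq> Hull X"
    proof (rule UN_least)
      fix s assume "s \<in> \<T>"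
      then show "Hull s \<subseteq> Hull X" unfolding Hull_def by (intro hull_mono image_mono sX)
    qed
    show "Hull X \<subseteq> \<Union> (Hull ` \<T>)"
    proof
      fix p assume "p \<in> Hull X"
      then obtain s w where s: "s \<in> \<T>" "bary X s w p" using tri_cover[OF T] by blast
      then show "p \<in> \<Union> (Hull ` \<T>)" using Hull_iff_bary[OF finite_X sX[OF s(1)]] by blast
    qed
  qed
  moreover have "\<forall>s\<in>\<T>. card s = 3 \<and> \<not> affine_dependent (emb ` s)"
    by (intro ballI conjI ind)
  ultimately show ?thesis unfolding is_triangulation_def using tri_Union[OF T] by (intro conjI)
qed

end

section \<open>Flipping the diagonal of a parallelogram\<close>

lemma bary_two:
  assumes X: "finite X" "s \<subseteq> X" and ab: "a \<in> s" "b \<in> s" "a \<noteq> b" and l: "0 \<le> l" "l \<le> 1"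
  shows "bary X s (\<lambda>v. if v = a then l else if v = b then 1 - l else 0) (l *\<^sub>R emb a + (1 - l) *\<^sub>R emb b)"
proof -
  let ?w = "\<lambda>v. if v = a then l else if v = b then 1 - l else 0"
  have sub: "{a, b} \<subseteq> X" using X ab by blast
  have "sum ?w X = sum ?w {a, b}" using X(1) sub by (intro sum.mono_neutral_right) auto
  moreover have "(\<Sum>v\<in>X. ?w v *\<^sub>R emb v) = (\<Sum>v\<in>{a, b}. ?w v *\<^sub>R emb v)"
    using X(1) sub by (intro sum.mono_neutral_right) auto
  ultimately show ?thesis using ab l unfolding bary_def by auto
qed

lemma unimodularI:
  assumes c: "card {a, b, c} = 3" and d: "\<bar>det2 (b - a) (c - a)\<bar> = 1"
  shows "unimodular {a, b, c}"
  unfolding unimodular_def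
proof (intro conjI allI impI)
  fix a' b' c' assume eq: "{a, b, c} = {a', b', c'}"
  have ne: "a \<noteq> b" "a \<noteq> c" "b \<noteq> c" using c by (auto simp: card_insert_if split: if_splits)
  have "card {a', b', c'} = 3" using c eq by simp
  then have ne': "a' \<noteq> b'" "a' \<noteq> c'" "b' \<noteq> c'" by (auto simp: card_insert_if split: if_splits)
  have m: "a' \<in> {a, b, c}" "b' \<in> {a, b, c}" "c' \<in> {a, b, c}" using eq by simp_all
  have p: "det2 (c - a) (b - a) = - det2 (b - a) (c - a)" "det2 (a - b) (c - b) = - det2 (b - a) (c - a)"
    "det2 (c - b) (a - b) = det2 (b - a) (c - a)" "det2 (a - c) (b - c) = det2 (b - a) (c - a)"
    "det2 (b - c) (a - c) = - det2 (b - a) (c - a)"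
    by (simp_all add: det2_def algebra_simps)
  show "\<bar>det2 (b' - a') (c' - a')\<bar> = 1"
    using m ne' d p by (elim insertE emptyE) simp_all
qed (rule c)

lemma card_3_distinct: "card {a, b, c} = 3 \<longleftrightarrow> a \<noteq> b \<and> a \<noteq> c \<and> b \<noteq> c"
  by (auto simp: card_insert_if)

text \<open>If \<open>x + t = y + z\<close>, moving as much weight as possible from \<open>y, z\<close> to \<open>x, t\<close> preserves the barycenter.\<close>

definition swap :: "point \<Rightarrow> point \<Rightarrow> point \<Rightarrow> point \<Rightarrow> (point \<Rightarrow> real) \<Rightarrow> point \<Rightarrow> real" where
  "swap x t y z w v = w v + (if v = x \<or> v = t then min (w y) (w z) else 0) -
     (if v = y \<or> v = z then min (w y) (w z) else 0)"

lemma sum_swap: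
  fixes h :: "point \<Rightarrow> 'b::real_vector"
  assumes X: "finite X" "{x, t, y, z} \<subseteq> X" and ne: "x \<noteq> t" "y \<noteq> z"
  shows "(\<Sum>v\<in>X. swap x t y z w v *\<^sub>R h v) = (\<Sum>v\<in>X. w v *\<^sub>R h v) + min (w y) (w z) *\<^sub>R (h x + h t - h y - h z)"
proof -
  have *: "(\<Sum>v\<in>X. (if v = a \<or> v = b then m else 0) *\<^sub>R h v) = m *\<^sub>R (h a + h b)"
    if "a \<in> X" "b \<in> X" "a \<noteq> b" for a b m
  proof -
    have "(\<Sum>v\<in>X. (if v = a \<or> v = b then m else 0) *\<^sub>R h v) = (\<Sum>v\<in>{a, b}. (if v = a \<or> v = b then m else 0) *\<^sub>R h v)"
      using X(1) that by (intro sum.mono_neutral_right) auto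
    then show ?thesis using that by (simp add: algebra_simps)
  qed
  show ?thesis
    using X ne unfolding swap_def
    by (simp add: scaleR_add_left scaleR_diff_left sum.distrib sum_subtractf * scaleR_add_right scaleR_diff_right)
qed

lemma swap_bary:
  assumes X: "finite X" "{x, t, y, z} \<subseteq> X" and ne: "distinct [x, t, y, z]" and par: "x + t = y + z"
    and b: "bary X s w p" and supp: "\<And>v. v \<notin> s' \<Longrightarrow> swap x t y z w v = 0"
  shows "bary X s' (swap x t y z w) p"
proof -
  have nn: "0 \<le> w v" for v by (rule bary_nonneg[OF b])
  have "0 \<le> swap x t y z w v" for v
    using nn[of v] nn[of x] nn[of t] nn[of y] nn[of z] ne by (auto simp: swap_def)
  moreover have "sum (swap x t y z w) X = 1"
    using sum_swap[OF X, of w "\<lambda>_. 1::real"] ne b by (simp add: bary_def)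
  moreover have "(\<Sum>v\<in>X. swap x t y z w v *\<^sub>R emb v) = p"
  proof -
    have "emb x + emb t - emb y - emb z = 0" using arg_cong[OF par, of emb] by (simp add: emb_add)
    then show ?thesis using sum_swap[OF X, of w emb] ne b by (simp add: bary_def)
  qed
  ultimately show ?thesis using supp by (simp add: bary_def)
qed

text \<open>The swap exhausts the weight of \<open>y\<close> or of \<open>z\<close>, which leaves a
  triangle on the diagonal \<open>[x, t]\<close>.\<close>

lemma swap_quad:
  assumes X: "finite X" "{x, t, y, z} \<subseteq> X" and ne: "distinct [x, t, y, z]" and par: "x + t = y + z"
    and b: "bary X {x, t, y, z} w p"
  shows "\<exists>r\<in>{y, z}. bary X {x, t, r} (swap x t y z w) p"
proof -
  note b' = swap_bary[OF X ne par b] and z0 = bary_zero[OF b]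
  show ?thesis
  proof (cases "w y \<le> w z")
    case True
    have "bary X {x, t, z} (swap x t y z w) p"
    proof (rule b')
      fix v assume "v \<notin> {x, t, z}"
      then show "swap x t y z w v = 0"
        using True z0[of v] ne by (cases "v = y") (simp_all add: swap_def)
    qed
    then show ?thesis by simp
  next
    case False
    have "bary X {x, t, y} (swap x t y z w) p"
    proof (rule b')
      fix v assume "v \<notin> {x, t, y}"
      then show "swap x t y z w v = 0"
        using False z0[of v] ne by (cases "v = z") (simp_all add: swap_def)
    qed
    then show ?thesis by simp
  qed
qed

lemma swap_id:
  assumes m: "min (w y) (w z) = 0" shows "swap x t y z w = w"
  by (rule ext) (unfold swap_def m, simp)

text \<open>If one of \<open>x\<close>, \<open>t\<close> had no weight, the amount moved is the
  minimum of their new weights and can be read back from them.\<close>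

lemma swap_inverse:
  assumes "distinct [x, t, y, z]" "min (w x) (w t) = 0"
  shows "swap y z x t (swap x t y z w) = w"
proof -
  let ?m = "min (w y) (w z)"
  have "swap x t y z w x = w x + ?m" "swap x t y z w t = w t + ?m"
    using assms(1) by (auto simp: swap_def)
  then have "min (swap x t y z w x) (swap x t y z w t) = ?m" using assms(2) by linarith
  then show ?thesis using assms(1) by (auto simp: swap_def[of y z x t] swap_def[of x t y z] fun_eq_iff)
qed

context lattice_polygon begin

text \<open>If \<open>y\<close> and \<open>v\<close> were on the same side of \<open>[x, t]\<close>, then the segments \<open>[v, x]\<close> and \<open>[y, t]\<close>, or \<open>[v, t]\<close> and
  \<open>[y, x]\<close>, would cross.\<close>

lemma opposite_vertex:
  assumes T: "tri X \<T>" and s: "{x, t, y} \<in> \<T>" "{x, t, v} \<in> \<T>" and "v \<noteq> y"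
  obtains k where "v - x = (k * fst (t - x) - fst (y - x), k * snd (t - x) - snd (y - x))"
proof -
  define c a b where "c = t - x" and "a = y - x" and "b = v - x"
  have sX: "{x, t, y} \<subseteq> X" "{x, t, v} \<subseteq> X" using tri_subset[OF T] s by blast+
  have u: "unimodular {x, t, y}" "unimodular {x, t, v}" using tri_unimodular[OF T] s by blast+
  have ne: "x \<noteq> t" "x \<noteq> y" "t \<noteq> y" "x \<noteq> v" "t \<noteq> v"
    using unimodular_card[OF u(1)] unimodular_card[OF u(2)] by (simp_all add: card_3_distinct)
  define D E where "D = det2 c a" and "E = det2 c b"
  have DE: "\<bar>D\<bar> = 1" "\<bar>E\<bar> = 1"
    using unimodular_det2[OF u(1)] unimodular_det2[OF u(2)] by (simp_all add: D_def E_def a_def b_def c_def)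
  have co: "D * fst b = det2 b a * fst c + E * fst a" "D * snd b = det2 b a * snd c + E * snd a"
    by (simp_all add: D_def E_def det2_def algebra_simps)
  have DD: "D * D = 1" using DE(1) by (metis abs_mult_self_eq mult_1)
  define k where "k = D * det2 b a"
  have b1: "fst b = k * fst c + D * E * fst a" "snd b = k * snd c + D * E * snd a"
  proof -
    have "fst b = D * (D * fst b)" "snd b = D * (D * snd b)" using DD by (simp_all flip: mult.assoc)
    then show "fst b = k * fst c + D * E * fst a" "snd b = k * snd c + D * E * snd a"
      unfolding co by (simp_all add: k_def algebra_simps)
  qed
  have "E = D \<or> E = - D" using DE by linarith
  then show thesis
  proof
    assume "E = - D"
    then have "D * E = - 1" using DD by simp
    then have "b = (k * fst c - fst a, k * snd c - snd a)" using b1 by (simp add: prod_eq_iff)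
    then show thesis by (intro that[of k]) (simp add: a_def b_def c_def)
  next
    assume "E = D"
    then have b: "fst b = k * fst c + fst a" "snd b = k * snd c + snd a" using b1 DD by simp_all
    then have v: "fst v = k * (fst t - fst x) + fst y" "snd v = k * (snd t - snd x) + snd y"
      by (simp_all add: a_def b_def c_def)
    have k0: "k \<noteq> 0" using v \<open>v \<noteq> y\<close> by (auto simp: prod_eq_iff)
    \<comment> \<open>The crossing point:
      \<open>v + \<bar>k\<bar> x' = y + \<bar>k\<bar> t'\<close>, and dividing by
      \<open>1 + \<bar>k\<bar>\<close> turns both sides into convex combinations. The sign of
      \<open>k\<close> decides which end of the edge is \<open>x'\<close>.\<close>
    define l where "l = 1 / (1 + \<bar>real_of_int k\<bar>)"
    have l: "0 < l" "l < 1" "1 - l = l * \<bar>real_of_int k\<bar>" using k0 by (simp_all add: l_def field_simps)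
    define x' t' where "x' = (if k > 0 then x else t)" and "t' = (if k > 0 then t else x)"
    have m: "x' \<in> {x, t}" "t' \<in> {x, t}" by (simp_all add: x'_def t'_def)
    have e: "emb v + \<bar>real_of_int k\<bar> *\<^sub>R emb x' = emb y + \<bar>real_of_int k\<bar> *\<^sub>R emb t'"
      using k0 by (cases "k > 0") (simp_all add: emb_def v x'_def t'_def algebra_simps)
    have "l *\<^sub>R (emb v + \<bar>real_of_int k\<bar> *\<^sub>R emb x') = l *\<^sub>R (emb y + \<bar>real_of_int k\<bar> *\<^sub>R emb t')"
      unfolding e ..
    then have e2: "l *\<^sub>R emb v + (1 - l) *\<^sub>R emb x' = l *\<^sub>R emb y + (1 - l) *\<^sub>R emb t'"
      unfolding l(3) by (simp add: scaleR_add_right)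
    have "v \<noteq> x'" "y \<noteq> t'" using m ne by auto
    then have w: "bary X {x, t, v} (\<lambda>q. if q = v then l else if q = x' then 1 - l else 0) (l *\<^sub>R emb v + (1 - l) *\<^sub>R emb x')"
      "bary X {x, t, y} (\<lambda>q. if q = y then l else if q = t' then 1 - l else 0) (l *\<^sub>R emb y + (1 - l) *\<^sub>R emb t')"
      using l(1,2) m sX by (auto intro!: bary_two[OF finite_X])
    have "(\<lambda>q. if q = v then l else if q = x' then 1 - l else 0) = (\<lambda>q. if q = y then l else if q = t' then 1 - l else 0)"
      using tri_conform[OF T s(2,1) w(1)] w(2) unfolding e2 by blast
    from fun_cong[OF this, of v] have "l = 0" using ne m \<open>v \<noteq> y\<close> by (auto split: if_splits)
    then show thesis using l by simp
  qed
qed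

end

locale flip = lattice_polygon +
  fixes \<T> x t y z
  assumes T: "tri X \<T>" and mem: "{x, y, t} \<in> \<T>" "{x, z, t} \<in> \<T>"
    and par: "x + t = y + z" and yz: "y \<noteq> z"
begin

definition \<T>' where "\<T>' = (\<T> - {{x, y, t}, {x, z, t}}) \<union> {{x, y, z}, {t, y, z}}"

lemma sub: "{x, t, y, z} \<subseteq> X"
  using tri_subset[OF T mem(1)] tri_subset[OF T mem(2)] by simp

lemma dist: "distinct [x, t, y, z]"
  using unimodular_card[OF tri_unimodular[OF T mem(1)]] unimodular_card[OF tri_unimodular[OF T mem(2)]] yz
  by (simp add: card_3_distinct) blast

lemma dist': "distinct [y, z, x, t]"
  using dist by auto

lemma sub': "{y, z, x, t} \<subseteq> X"
  using sub by auto

lemma half: "(1/2) *\<^sub>R emb x + (1 - 1/2) *\<^sub>R emb t = (1/2) *\<^sub>R emb y + (1 - 1/2) *\<^sub>R emb z"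
proof -
  have "(1/2) *\<^sub>R (emb x + emb t) = (1/2) *\<^sub>R (emb y + emb z)" using arg_cong[OF par, of emb] by (simp add: emb_add)
  then show ?thesis by (simp add: scaleR_add_right)
qed

text \<open>The diagonals share their midpoint, which would receive one set of weights on
  \<open>y, z\<close> and another on \<open>x, t\<close>.\<close>

lemma not_yz: assumes "s \<in> \<T>" "y \<in> s" "z \<in> s" shows False
proof -
  have "bary X s (\<lambda>v. if v = y then 1/2 else if v = z then 1 - 1/2 else 0) ((1/2) *\<^sub>R emb y + (1 - 1/2) *\<^sub>R emb z)"
    using assms dist by (intro bary_two finite_X tri_subset[OF T]) auto
  moreover have "bary X {x, y, t} (\<lambda>v. if v = x then 1/2 else if v = t then 1 - 1/2 else 0) ((1/2) *\<^sub>R emb x + (1 - 1/2) *\<^sub>R emb t)"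
    using mem dist by (intro bary_two finite_X tri_subset[OF T]) auto
  ultimately have eq: "(\<lambda>v. if v = y then 1/2 else if v = z then 1 - 1/2 else 0 :: real) = (\<lambda>v. if v = x then 1/2 else if v = t then 1 - 1/2 else 0)"
    unfolding half by (rule tri_conform[OF T assms(1) mem(1)])
  have "y \<noteq> x" "y \<noteq> t" using dist by auto
  then show False using fun_cong[OF eq, of y] by simp
qed

text \<open>A third triangle on \<open>[x, t]\<close> would have its vertex opposite to both
  \<open>y\<close> and \<open>z\<close>. The two relations make \<open>2 (y - x)\<close> an integer
  multiple of \<open>t - x\<close>, against unimodularity.\<close>

lemma xt_cases: assumes s: "s \<in> \<T>" "x \<in> s" "t \<in> s" shows "s = {x, y, t} \<or> s = {x, z, t}"
proof (rule ccontr)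
  assume n: "\<not> ?thesis"
  have "card s = 3" using unimodular_card tri_unimodular[OF T] s by blast
  then have "card (s - {x, t}) = 1" using s dist by (simp add: card_Diff_subset)
  then obtain v where "s - {x, t} = {v}" by (auto simp: card_1_singleton_iff)
  then have sv: "s = {x, t, v}" using s by blast
  have ne: "v \<noteq> y" "v \<noteq> z" using n sv by auto
  have m: "{x, t, y} \<in> \<T>" "{x, t, z} \<in> \<T>" "{x, t, v} \<in> \<T>" using mem s sv by (simp_all add: insert_commute)
  obtain k where k: "v - x = (k * fst (t - x) - fst (y - x), k * snd (t - x) - snd (y - x))"
    using opposite_vertex[OF T m(1,3) ne(1)] .
  obtain k' where k': "v - x = (k' * fst (t - x) - fst (z - x), k' * snd (t - x) - snd (z - x))"
    using opposite_vertex[OF T m(2,3) ne(2)] .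
  have z: "z = x + t - y" using par by (simp add: algebra_simps)
  have "2 * fst (y - x) = (k - k' + 1) * fst (t - x)" "2 * snd (y - x) = (k - k' + 1) * snd (t - x)"
    using k k' by (simp_all add: z algebra_simps)
  note e = this
  have "2 * det2 (t - x) (y - x) = fst (t - x) * (2 * snd (y - x)) - snd (t - x) * (2 * fst (y - x))"
    by (simp add: det2_def algebra_simps)
  also have "\<dots> = 0" unfolding e by simp
  finally have "2 * det2 (t - x) (y - x) = 0" .
  moreover have "\<bar>det2 (t - x) (y - x)\<bar> = 1" using unimodular_det2 tri_unimodular[OF T m(1)] by blast
  ultimately show False by simp
qed

text \<open>Weights for the flipped triangulation are carried to weights for the old one,
  injectively because no new triangle contains both \<open>x\<close> and \<open>t\<close>.
  Uniqueness of weights is thus inherited; \<open>swap_back\<close> does the same for the covering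
  property.\<close>

lemma swap_into:
  assumes s: "s \<in> \<T>'" and b: "bary X s w p"
  shows "\<exists>s0\<in>\<T>. bary X s0 (swap x t y z w) p" "swap y z x t (swap x t y z w) = w"
proof -
  have nn: "0 \<le> w v" for v by (rule bary_nonneg[OF b])
  have z0: "v \<notin> s \<Longrightarrow> w v = 0" for v by (rule bary_zero[OF b])
  show "\<exists>s0\<in>\<T>. bary X s0 (swap x t y z w) p"
  proof (cases "s = {x, y, z} \<or> s = {t, y, z}")
    case True
    then have "bary X {x, t, y, z} w p" by (intro bary_sub[OF b]) auto
    from swap_quad[OF finite_X sub dist par this]
    obtain r where r: "r \<in> {y, z}" "bary X {x, t, r} (swap x t y z w) p" by (rule bexE)
    have "{x, t, r} \<in> \<T>" using r(1) mem by (auto simp: insert_commute)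
    then show ?thesis using r(2) by (rule bexI[rotated])
  next
    case False
    then have sT: "s \<in> \<T>" using s by (auto simp: \<T>'_def)
    then have "y \<notin> s \<or> z \<notin> s" using not_yz by blast
    then have "w y = 0 \<or> w z = 0" using z0 by blast
    then have "min (w y) (w z) = 0" using nn[of y] nn[of z] by linarith
    then have "swap x t y z w = w" by (rule swap_id)
    then show ?thesis using b by (intro bexI[OF _ sT]) (simp only:)
  qed
  have "w x = 0 \<or> w t = 0"
  proof (rule ccontr)
    assume "\<not> ?thesis"
    then have xs: "x \<in> s" "t \<in> s" using z0[of x] z0[of t] by blast+
    then have "s \<noteq> {x, y, z}" "s \<noteq> {t, y, z}" using dist by auto
    then have "s \<in> \<T>" "s \<noteq> {x, y, t}" "s \<noteq> {x, z, t}" using s by (auto simp: \<T>'_def)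
    then show False using xt_cases xs by blast
  qed
  then have "min (w x) (w t) = 0" using nn[of x] nn[of t] by linarith
  then show "swap y z x t (swap x t y z w) = w" by (rule swap_inverse[OF dist])
qed

lemma swap_back:
  assumes s: "s \<in> \<T>" and b: "bary X s w p"
  shows "\<exists>s0\<in>\<T>'. bary X s0 (swap y z x t w) p"
proof (cases "s = {x, y, t} \<or> s = {x, z, t}")
  case True
  then have "bary X {y, z, x, t} w p" by (intro bary_sub[OF b]) auto
  from swap_quad[OF finite_X sub' dist' par[symmetric] this]
  obtain r where r: "r \<in> {x, t}" "bary X {y, z, r} (swap y z x t w) p" by (rule bexE)
  have "{y, z, r} \<in> \<T>'" using r(1) by (auto simp: insert_commute \<T>'_def)
  then show ?thesis using r(2) by (rule bexI[rotated])
next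
  case False
  then have "x \<notin> s \<or> t \<notin> s" using xt_cases[OF s] by blast
  then have "w x = 0 \<or> w t = 0" using bary_zero[OF b] by blast
  then have "min (w x) (w t) = 0" using bary_nonneg[OF b, of x] bary_nonneg[OF b, of t] by linarith
  then have "swap y z x t w = w" by (rule swap_id)
  moreover have "s \<in> \<T>'" using False s by (simp add: \<T>'_def)
  ultimately show ?thesis using b by (intro bexI[of _ s]) (simp_all only:)
qed

lemma tri_flip: "tri X \<T>'"
proof -
  have f1: "s \<subseteq> X \<and> unimodular s" if "s \<in> \<T>'" for s
  proof -
    have d: "\<bar>det2 (t - x) (y - x)\<bar> = 1" using unimodular_det2[of x t y] tri_unimodular[OF T mem(1)] by (simp add: insert_commute)
    have z: "z = x + t - y" using par by (simp add: algebra_simps)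
    have e: "det2 (y - x) (z - x) = - det2 (t - x) (y - x)" "det2 (y - t) (z - t) = det2 (t - x) (y - x)"
      by (simp_all add: z det2_def algebra_simps)
    have c: "card {x, y, z} = 3" "card {t, y, z} = 3" unfolding card_3_distinct using dist by auto
    have "unimodular {x, y, z}" by (rule unimodularI[OF c(1)]) (simp only: e(1) abs_minus_cancel d)
    moreover have "unimodular {t, y, z}" by (rule unimodularI[OF c(2)]) (simp only: e(2) d)
    moreover have "s \<in> \<T> \<or> s = {x, y, z} \<or> s = {t, y, z}" using that by (auto simp: \<T>'_def)
    moreover have "{x, y, z} \<subseteq> X" "{t, y, z} \<subseteq> X" using sub by simp_all
    ultimately show ?thesis using tri_subset[OF T, of s] tri_unimodular[OF T, of s] by (elim disjE) simp_all
  qed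
  have conf: "w = w'" if h: "s \<in> \<T>'" "s' \<in> \<T>'" "bary X s w p" "bary X s' w' p" for s s' w w' p
  proof -
    obtain s0 where s0: "s0 \<in> \<T>" "bary X s0 (swap x t y z w) p"
      using swap_into(1)[OF h(1,3)] by (rule bexE)
    obtain s1 where s1: "s1 \<in> \<T>" "bary X s1 (swap x t y z w') p"
      using swap_into(1)[OF h(2,4)] by (rule bexE)
    have "swap x t y z w = swap x t y z w'" by (rule tri_conform[OF T s0(1) s1(1) s0(2) s1(2)])
    from arg_cong[OF this, of "swap y z x t"] show ?thesis
      unfolding swap_into(2)[OF h(1,3)] swap_into(2)[OF h(2,4)] .
  qed
  have f2: "\<forall>s\<in>\<T>'. \<forall>s'\<in>\<T>'. \<forall>w w' p. bary X s w p \<longrightarrow> bary X s' w' p \<longrightarrow> w = w'"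
    by (intro ballI allI impI) (rule conf)
  have f3: "\<exists>s\<in>\<T>'. \<exists>w. bary X s w p" if "p \<in> Hull X" for p
  proof -
    obtain s w where s: "s \<in> \<T>" "bary X s w p" using tri_cover[OF T \<open>p \<in> Hull X\<close>] by (elim bexE exE)
    obtain s0 where "s0 \<in> \<T>'" "bary X s0 (swap y z x t w) p" using swap_back[OF s] by (rule bexE)
    then show ?thesis by (intro bexI exI)
  qed
  have f4: "\<Union> \<T>' = X"
  proof
    show "\<Union> \<T>' \<subseteq> X" by (rule Union_least) (simp add: f1)
    show "X \<subseteq> \<Union> \<T>'"
    proof
      fix v assume "v \<in> X"
      then obtain s where s: "s \<in> \<T>" "v \<in> s" using tri_Union[OF T] by blast
      have new: "{x, y, z} \<in> \<T>'" "{t, y, z} \<in> \<T>'" by (simp_all add: \<T>'_def)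
      show "v \<in> \<Union> \<T>'"
      proof (cases "s = {x, y, t} \<or> s = {x, z, t}")
        case True
        then have "v \<in> {x, y, z} \<or> v \<in> {t, y, z}" using s(2) by blast
        then show ?thesis using UnionI[OF new(1), of v] UnionI[OF new(2), of v] by (elim disjE)
      next
        case False
        then have "s \<in> \<T>'" using s(1) by (simp add: \<T>'_def)
        then show ?thesis using s(2) by (rule UnionI)
      qed
    qed
  qed
  show ?thesis unfolding tri_def
    by (intro conjI f2 f4; intro ballI; (rule f1 | rule f3))
qed

lemma Hull_quad: "Hull {x, y, t} \<union> Hull {x, z, t} = Hull {x, y, z, t}"
proof
  show "Hull {x, y, t} \<union> Hull {x, z, t} \<subseteq> Hull {x, y, z, t}"
    unfolding Hull_def by (intro Un_least hull_mono image_mono) auto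
  show "Hull {x, y, z, t} \<subseteq> Hull {x, y, t} \<union> Hull {x, z, t}"
  proof
    fix p assume "p \<in> Hull {x, y, z, t}"
    then obtain w where b: "bary X {x, y, z, t} w p"
      using Hull_iff_bary[OF finite_X, of "{x, y, z, t}" p] sub by auto
    then have "bary X {x, t, y, z} w p" by (rule bary_sub) auto
    from swap_quad[OF finite_X sub dist par this]
    obtain r where r: "r \<in> {y, z}" "bary X {x, t, r} (swap x t y z w) p" by (rule bexE)
    then have "{x, t, r} \<subseteq> X" using sub by auto
    then have "p \<in> Hull {x, t, r}" using r(2) Hull_iff_bary[OF finite_X, of "{x, t, r}" p] by auto
    then show "p \<in> Hull {x, y, t} \<union> Hull {x, z, t}" using r(1) by (auto simp: insert_commute)
  qed
qed

lemma extreme_quad: "{p. p extreme_point_of Hull {x, y, z, t}} = emb ` {x, y, z, t}"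
proof -
  have nonmem: "emb v \<notin> convex hull (emb ` {x, y, z, t} - {emb v})" if v: "v \<in> {x, y, z, t}" for v
  proof
    let ?Q = "{x, y, z, t} - {v}"
    assume "emb v \<in> convex hull (emb ` {x, y, z, t} - {emb v})"
    moreover have "emb ` {x, y, z, t} - {emb v} = emb ` ?Q"
      using image_set_diff[OF inj_emb, of "{x, y, z, t}" "{v}"] by simp
    ultimately have "emb v \<in> Hull ?Q" by (simp only: Hull_def)
    moreover have "?Q \<subseteq> X" using sub by auto
    ultimately obtain w where b: "bary X ?Q w (emb v)" using Hull_iff_bary[OF finite_X, of ?Q "emb v"] by auto
    have wv: "w v = 0" using bary_zero[OF b] by simp
    have nn: "0 \<le> w v" for v by (rule bary_nonneg[OF b])
    have "bary X {x, t, y, z} w (emb v)" by (rule bary_sub[OF b]) auto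
    from swap_quad[OF finite_X sub dist par this]
    obtain r where r: "r \<in> {y, z}" and b2: "bary X {x, t, r} (swap x t y z w) (emb v)" by (rule bexE)
    have rT: "{x, t, r} \<in> \<T>" using r mem by (auto simp: insert_commute)
    have "v \<in> \<Union> \<T>" unfolding tri_Union[OF T] using v sub by auto
    then obtain s where s: "s \<in> \<T>" "v \<in> s" by (rule UnionE)
    \<comment> \<open>If \<open>v\<close> were a combination of the other three corners, swapping
      would still represent it, so uniqueness forces the unit weight at \<open>v\<close>. The four
      values of the swap are incompatible with \<open>w v = 0\<close>.\<close>
    have eq: "swap x t y z w = (\<lambda>q. if q = v then 1 else 0)"
      using tri_conform[OF T rT s(1) b2 bary_vertex[OF finite_X tri_subset[OF T s(1)] s(2)]] .
    have ev: "swap x t y z w q = (if q = v then 1 else 0)" for q using fun_cong[OF eq, of q] .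
    have "swap x t y z w x = w x + min (w y) (w z)" "swap x t y z w t = w t + min (w y) (w z)"
      "swap x t y z w y = w y - min (w y) (w z)" "swap x t y z w z = w z - min (w y) (w z)"
      using dist by (auto simp: swap_def)
    note val = this[unfolded ev]
    consider "v = x" | "v = t" | "v = y" | "v = z" using v by (elim insertE emptyE)
    then show False
    proof cases
      case 1
      then have "t \<noteq> v" using dist by auto
      then show False using val(1,2) wv nn[of t] nn[of y] nn[of z] 1 by simp
    next
      case 2
      then have "x \<noteq> v" using dist by auto
      then show False using val(1,2) wv nn[of x] nn[of y] nn[of z] 2 by simp
    next
      case 3
      then show False using val(3) wv nn[of z] by simp
    next
      case 4
      then show False using val(4) wv nn[of y] by simp
    qed
  qed
  have "compact (emb ` {x, y, z, t})" by (intro finite_imp_compact finite_imageI finite.intros)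
  moreover have "a \<notin> convex hull (emb ` {x, y, z, t} - {a})" if a: "a \<in> emb ` {x, y, z, t}" for a
  proof -
    obtain v where v: "a = emb v" "v \<in> {x, y, z, t}" using a by (rule imageE)
    show ?thesis unfolding v(1) by (rule nonmem[OF v(2)])
  qed
  ultimately have "p extreme_point_of convex hull (emb ` {x, y, z, t}) \<longleftrightarrow> p \<in> emb ` {x, y, z, t}" for p
    by (rule extreme_point_of_convex_hull_convex_independent)
  then show ?thesis unfolding Hull_def by (simp only: Collect_mem_eq)
qed

lemma edge_flip: "edge_flip \<T> \<T>'"
proof -
  have "distinct [x, y, z, t]" using dist by (simp only: distinct.simps list.set insert_iff empty_iff) blast
  from distinct_card[OF this] have c: "card {x, y, z, t} = 4" by simp
  have conv: "convex (Hull {x, y, t} \<union> Hull {x, z, t})" unfolding Hull_quad by (simp add: Hull_def)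
  have ext: "{p. p extreme_point_of (Hull {x, y, t} \<union> Hull {x, z, t})} = emb ` {x, y, z, t}"
    unfolding Hull_quad by (rule extreme_quad)
  have seg: "open_segment (emb x) (emb t) \<inter> open_segment (emb y) (emb z) \<noteq> {}"
  proof -
    have "midpoint (emb x) (emb t) = midpoint (emb y) (emb z)"
      using arg_cong[OF par, of emb] by (simp add: midpoint_def emb_add)
    moreover have "midpoint (emb x) (emb t) \<in> open_segment (emb x) (emb t)"
      "midpoint (emb y) (emb z) \<in> open_segment (emb y) (emb z)"
      using dist by (simp_all add: emb_eq_iff)
    ultimately show ?thesis by auto
  qed
  show ?thesis unfolding edge_flip_def
    by (rule exI[of _ x], rule exI[of _ y], rule exI[of _ z], rule exI[of _ t])
      (intro conjI mem c conv ext seg \<T>'_def)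
qed

lemma flip_value:
  assumes "s \<in> \<T>" "bary X s w p"
  shows "\<exists>s'\<in>\<T>'. \<exists>w'. bary X s' w' p \<and>
    (\<Sum>v\<in>X. w' v * u v) = (\<Sum>v\<in>X. w v * u v) + min (w x) (w t) * (u y + u z - u x - u t)"
proof -
  obtain s' where s': "s' \<in> \<T>'" "bary X s' (swap y z x t w) p" using swap_back[OF assms] by (rule bexE)
  have "y \<noteq> z" "x \<noteq> t" using dist by auto
  from sum_swap[OF finite_X sub' this, of w u]
  have "(\<Sum>v\<in>X. swap y z x t w v * u v) = (\<Sum>v\<in>X. w v * u v) + min (w x) (w t) * (u y + u z - u x - u t)"
    by (simp only: real_scaleR_def)
  then show ?thesis by (intro bexI[OF _ s'(1)] exI[of _ "swap y z x t w"] conjI s'(2))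
qed

end

section \<open>Local and global convexity\<close>

lemma bary_affine:
  assumes b: "bary X s w p" and g: "\<forall>v\<in>s. u v = g \<bullet> emb v + C"
  shows "(\<Sum>v\<in>X. w v * u v) = g \<bullet> p + C"
proof -
  have "w v * u v = g \<bullet> (w v *\<^sub>R emb v) + C * w v" for v
    using bary_zero[OF b, of v] g by (cases "v \<in> s") (simp_all add: algebra_simps)
  then have "(\<Sum>v\<in>X. w v * u v) = g \<bullet> (\<Sum>v\<in>X. w v *\<^sub>R emb v) + C * sum w X"
    by (simp add: sum.distrib inner_sum_right sum_distrib_left)
  then show ?thesis using b by (simp add: bary_def)
qed

lemma affine_interpolation:
  assumes "unimodular s"
  shows "\<exists>gC :: (real \<times> real) \<times> real. \<forall>v\<in>s. u v = fst gC \<bullet> emb v + snd gC"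
proof -
  obtain a b c where s: "s = {a, b, c}" using assms unfolding unimodular_def card_3_iff by blast
  define f h where "f = b - a" and "h = c - a"
  define D where "D = real_of_int (det2 f h)"
  have "\<bar>det2 f h\<bar> = 1" using unimodular_det2[of a b c] assms by (simp add: s f_def h_def)
  then have "det2 f h = 1 \<or> det2 f h = - 1" by linarith
  then have D: "D * D = 1" unfolding D_def by (elim disjE) simp_all
  \<comment> \<open>Cramer's rule; \<open>D\<close> is 1 or -1, so division by it is
    multiplication.\<close>
  define g where "g = (D * ((u b - u a) * snd h - (u c - u a) * snd f), D * ((u c - u a) * fst f - (u b - u a) * fst h))"
  have Df: "real_of_int (fst f) * snd h - snd f * fst h = D" by (simp add: D_def det2_def)
  have "g \<bullet> emb f = D * ((u b - u a) * (real_of_int (fst f) * snd h - snd f * fst h))"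
    by (simp add: g_def emb_def algebra_simps)
  then have f: "g \<bullet> emb f = u b - u a" unfolding Df using D by (simp add: mult.left_commute[of D])
  have "g \<bullet> emb h = D * ((u c - u a) * (real_of_int (fst f) * snd h - snd f * fst h))"
    by (simp add: g_def emb_def algebra_simps)
  then have h: "g \<bullet> emb h = u c - u a" unfolding Df using D by (simp add: mult.left_commute[of D])
  have "u v = g \<bullet> emb v + (u a - g \<bullet> emb a)" if "v \<in> s" for v
    using that f h unfolding s f_def h_def emb_diff inner_diff_right by (elim insertE emptyE) simp_all
  then show ?thesis by (intro exI[of _ "(g, u a - g \<bullet> emb a)"]) simp
qed

text \<open>The counterpart of \<open>det2\<close> for real vectors.\<close>

definition cr :: "real \<times> real \<Rightarrow> real \<times> real \<Rightarrow> real" where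
  "cr a b = fst a * snd b - snd a * fst b"

context lattice_polygon begin

lemma interp_eq:
  assumes T: "tri X \<T>" and s: "s \<in> \<T>" and b: "bary X s w p"
  shows "interp \<T> u p = (\<Sum>v\<in>X. w v * u v)"
  unfolding interp_def
proof (rule the_equality)
  have sX: "s \<subseteq> X" by (rule tri_subset[OF T s])
  note w = baryD[OF finite_X sX b]
  have "(\<Sum>v\<in>X. w v * u v) = (\<Sum>v\<in>s. w v * u v)"
    using sum_supp[OF finite_X sX, of w u] bary_zero[OF b] by simp
  then show "\<exists>t\<in>\<T>. \<exists>w'. (\<forall>v\<in>t. 0 \<le> w' v) \<and> sum w' t = 1 \<and> p = (\<Sum>v\<in>t. w' v *\<^sub>R emb v) \<and>
      (\<Sum>v\<in>X. w v * u v) = (\<Sum>v\<in>t. w' v * u v)"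
    using w s by (intro bexI[of _ s] exI[of _ w] conjI) simp_all
next
  fix r assume "\<exists>t\<in>\<T>. \<exists>w'. (\<forall>v\<in>t. 0 \<le> w' v) \<and> sum w' t = 1 \<and> p = (\<Sum>v\<in>t. w' v *\<^sub>R emb v) \<and>
      r = (\<Sum>v\<in>t. w' v * u v)"
  then obtain t w' where t: "t \<in> \<T>" and w': "\<forall>v\<in>t. 0 \<le> w' v" "sum w' t = 1" "p = (\<Sum>v\<in>t. w' v *\<^sub>R emb v)"
    and r: "r = (\<Sum>v\<in>t. w' v * u v)" by (elim bexE exE conjE)
  define w0 where "w0 v = (if v \<in> t then w' v else 0)" for v
  have tX: "t \<subseteq> X" by (rule tri_subset[OF T t])
  have "bary X t w0 p" unfolding w0_def by (rule bary_restrict[OF finite_X tX w'(1,2) w'(3)[symmetric]])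
  then have eq: "w0 = w" by (rule tri_conform[OF T t s _ b])
  have "(\<Sum>v\<in>X. w0 v * u v) = (\<Sum>v\<in>t. w0 v * u v)"
    using sum_supp[OF finite_X tX, of w0 u] by (simp add: w0_def)
  also have "\<dots> = r" unfolding r by (rule sum.cong) (simp_all add: w0_def)
  finally show "r = (\<Sum>v\<in>X. w v * u v)" unfolding eq by (rule sym)
qed

lemma interp_vertex:
  assumes T: "tri X \<T>" and a: "a \<in> X"
  shows "interp \<T> u (emb a) = u a"
proof -
  have "a \<in> \<Union> \<T>" unfolding tri_Union[OF T] by (rule a)
  then obtain s where s: "s \<in> \<T>" "a \<in> s" by (rule UnionE)
  have "interp \<T> u (emb a) = (\<Sum>v\<in>X. (if v = a then 1 else 0) * u v)"
    by (rule interp_eq[OF T s(1) bary_vertex[OF finite_X tri_subset[OF T s(1)] s(2)]])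
  also have "\<dots> = (\<Sum>v\<in>X. if v = a then u v else 0)" by (rule sum.cong) simp_all
  finally show ?thesis using a finite_X by simp
qed

lemma interp_mid:
  assumes T: "tri X \<T>" and s: "s \<in> \<T>" "a \<in> s" "b \<in> s" and ne: "a \<noteq> b"
  shows "interp \<T> u ((1/2) *\<^sub>R emb a + (1/2) *\<^sub>R emb b) = (u a + u b) / 2"
proof -
  have sX: "s \<subseteq> X" by (rule tri_subset[OF T s(1)])
  let ?w = "\<lambda>v. if v = a then 1/2 else if v = b then 1/2 else 0 :: real"
  have h: "(1::real) - 1/2 = 1/2" by simp
  have "bary X s ?w ((1/2) *\<^sub>R emb a + (1/2) *\<^sub>R emb b)"
    by (rule bary_two[OF finite_X sX s(2,3) ne, of "1/2", unfolded h]) simp_all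
  from interp_eq[OF T s(1) this, of u]
  have "interp \<T> u ((1/2) *\<^sub>R emb a + (1/2) *\<^sub>R emb b) = (\<Sum>v\<in>X. ?w v * u v)" .
  also have "\<dots> = (\<Sum>v\<in>{a, b}. ?w v * u v)"
    using finite_X sX s by (intro sum.mono_neutral_right) auto
  also have "\<dots> = (u a + u b) / 2" using ne by simp
  finally show ?thesis .
qed

lemma vertex_in_Hull:
  assumes T: "tri X \<T>" and s: "s \<in> \<T>" and a: "a \<in> X" "emb a \<in> Hull s"
  shows "a \<in> s"
proof -
  have "a \<in> \<Union> \<T>" unfolding tri_Union[OF T] by (rule a)
  then obtain s' where s': "s' \<in> \<T>" "a \<in> s'" by (rule UnionE)
  obtain w where w: "bary X s w (emb a)" using a(2) Hull_iff_bary[OF finite_X tri_subset[OF T s]] by blast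
  have "w = (\<lambda>v. if v = a then 1 else 0)"
    by (rule tri_conform[OF T s s'(1) w bary_vertex[OF finite_X tri_subset[OF T s'(1)] s'(2)]])
  then have "w a \<noteq> 0" by simp
  then show ?thesis using bary_zero[OF w, of a] by (rule contrapos_np)
qed

text \<open>The parabola \<open>a + \<theta> f + \<theta>\<^sup>2 h\<close> meets each line in finitely many points.\<close>

lemma generic_point:
  assumes s: "unimodular s" "s \<subseteq> X"
  shows "\<exists>p\<in>Hull s. \<forall>v'\<in>X - {v}. cr (p - emb v) (emb v' - emb v) \<noteq> 0"
proof -
  obtain a b c where abc: "s = {a, b, c}" using s unfolding unimodular_def card_3_iff by blast
  define f h where "f = b - a" and "h = c - a"
  have D: "det2 f h \<noteq> 0" using unimodular_det2[of a b c] s by (auto simp: abc f_def h_def)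
  define P where "P \<theta> = emb a + \<theta> *\<^sub>R emb f + (\<theta> * \<theta>) *\<^sub>R emb h" for \<theta>
  define Bad where "Bad v' = {\<theta>. cr (P \<theta> - emb v) (emb v' - emb v) = 0}" for v'
  have fin: "finite (Bad v')" if "v' \<in> X - {v}" for v'
  proof -
    define e where "e = v' - v"
    have e: "e \<noteq> 0" using that by (simp add: e_def)
    \<comment> \<open>As \<open>f\<close> and \<open>h\<close> span the plane, \<open>e\<close> is
      not parallel to both, so the polynomial in \<theta> has a nonzero coefficient in degree 1 or
      2.\<close>
    have "det2 f e \<noteq> 0 \<or> det2 h e \<noteq> 0"
    proof (rule ccontr)
      assume n: "\<not> ?thesis"
      have "det2 f h * fst e = fst h * det2 f e - fst f * det2 h e" "det2 f h * snd e = snd h * det2 f e - snd f * det2 h e"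
        by (simp_all add: det2_def algebra_simps)
      then show False using n D e by (simp add: prod_eq_iff)
    qed
    then have nz: "[:cr (emb a - emb v) (emb e), real_of_int (det2 f e), real_of_int (det2 h e):] \<noteq> 0" by auto
    have "Bad v' = {\<theta>. poly [:cr (emb a - emb v) (emb e), real_of_int (det2 f e), real_of_int (det2 h e):] \<theta> = 0}"
      unfolding Bad_def P_def by (simp add: cr_def emb_def e_def det2_def algebra_simps)
    then show ?thesis using poly_roots_finite[OF nz] by simp
  qed
  have "finite (\<Union>v'\<in>X - {v}. Bad v')" using finite_X fin by blast
  \<comment> \<open>Below 1/2 the weights stay nonnegative, since
    \<open>\<theta> + \<theta>\<^sup>2 \<le> 2 \<theta> < 1\<close>.\<close>
  moreover have "infinite {0<..<1/2 :: real}" by (rule infinite_Ioo) simp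
  ultimately have "\<not> {0<..<1/2 :: real} \<subseteq> (\<Union>v'\<in>X - {v}. Bad v')" using finite_subset by blast
  then obtain \<theta> :: real where "\<theta> \<in> {0<..<1/2}" and bad: "\<theta> \<notin> (\<Union>v'\<in>X - {v}. Bad v')" by blast
  then have t: "0 < \<theta>" "\<theta> < 1/2" by simp_all
  have sq: "\<theta> * \<theta> \<le> \<theta> * 1" using t by (intro mult_left_mono) auto
  have "P \<theta> = (1 - \<theta> - \<theta> * \<theta>) *\<^sub>R emb a + \<theta> *\<^sub>R emb b + (\<theta> * \<theta>) *\<^sub>R emb c"
    by (simp add: P_def f_def h_def emb_diff algebra_simps)
  moreover have "1 - \<theta> - \<theta> * \<theta> \<ge> 0" using sq t by linarith
  ultimately have "P \<theta> \<in> convex hull {emb a, emb b, emb c}"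
    unfolding convex_hull_3 using t
    by (intro CollectI exI[of _ "1 - \<theta> - \<theta> * \<theta>"] exI[of _ \<theta>] exI[of _ "\<theta> * \<theta>"]) simp
  then have "P \<theta> \<in> Hull s" by (simp add: Hull_def abc)
  then show ?thesis using bad by (intro bexI[of _ "P \<theta>"]) (auto simp: Bad_def)
qed

lemma convex_combination_mem:
  assumes "p \<in> Hull X" "v \<in> X" "0 \<le> \<theta>" "\<theta> \<le> 1"
  shows "p + \<theta> *\<^sub>R (emb v - p) \<in> Hull X"
proof -
  have "emb v \<in> Hull X" unfolding Hull_def by (rule hull_inc) (rule imageI[OF assms(2)])
  moreover have "convex (Hull X)" by (simp add: Hull_def)
  ultimately have "(1 - \<theta>) *\<^sub>R p + \<theta> *\<^sub>R emb v \<in> Hull X"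
    using assms by (intro convexD) auto
  then show ?thesis by (simp add: algebra_simps)
qed

lemma compact_Hull: "s \<subseteq> X \<Longrightarrow> compact (Hull s)"
  unfolding Hull_def using finite_subset[OF _ finite_X] by (intro finite_imp_compact_convex_hull) blast

text \<open>The weights of \<open>p\<close> live on the common vertices. A single one would make
  \<open>p\<close> a vertex, so there are two.\<close>

lemma common_edge:
  assumes T: "tri X \<T>" and s: "s \<in> \<T>" "s' \<in> \<T>" "s \<noteq> s'"
    and w: "bary X s w p" "bary X s' w p" and p: "\<forall>a\<in>X. p \<noteq> emb a"
  shows "\<exists>a b c d. s = {a, b, c} \<and> s' = {a, b, d} \<and> c \<noteq> d"
proof -
  have i: "bary X (s \<inter> s') w p" by (rule bary_Int[OF w])
  have sub: "s \<inter> s' \<subseteq> X" using tri_subset[OF T s(1)] by blast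
  have "s \<inter> s' \<noteq> {}" using baryD(2)[OF finite_X sub i] by auto
  then obtain a where a: "a \<in> s" "a \<in> s'" by blast
  have aX: "a \<in> X" using a tri_subset[OF T s(1)] by blast
  have "\<not> s \<inter> s' \<subseteq> {a}"
  proof
    assume "s \<inter> s' \<subseteq> {a}"
    then have "bary X {a} w p" by (rule bary_sub[OF i])
    from baryD(2,3)[OF finite_X _ this] aX have "p = emb a" by simp
    then show False using p aX by blast
  qed
  then obtain b where b: "b \<in> s" "b \<in> s'" "b \<noteq> a" by blast
  have third: "\<exists>c. r = {a, b, c}" if "r \<in> \<T>" "a \<in> r" "b \<in> r" for r
  proof -
    have "card r = 3" by (rule unimodular_card[OF tri_unimodular[OF T that(1)]])
    then have "card (r - {a, b}) = 1" using that b(3) by (simp add: card_Diff_subset)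
    then obtain c where "r - {a, b} = {c}" by (auto simp: card_1_singleton_iff)
    then have "r = {a, b, c}" using that by blast
    then show ?thesis by blast
  qed
  obtain c where c: "s = {a, b, c}" using third[OF s(1) a(1) b(1)] by blast
  obtain d where d: "s' = {a, b, d}" using third[OF s(2) a(2) b(2)] by blast
  show ?thesis using c d s(3) by blast
qed

text \<open>Among the triangles whose affine extension is maximal at \<open>v\<close>, follow a generic segment towards
  \<open>v\<close> up to its last point in their union. There it crosses the interior of an edge, and local
  convexity across this edge contradicts the choice of the last point.\<close>

lemma local_to_global:
  assumes T: "tri X \<T>"
    and LC: "\<And>a b c d g C. {a, b, c} \<in> \<T> \<Longrightarrow> {a, b, d} \<in> \<T> \<Longrightarrow> c \<noteq> d \<Longrightarrow>
      \<forall>v\<in>{a, b, c}. u v = g \<bullet> emb v + C \<Longrightarrow> g \<bullet> emb d + C \<le> u d"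
    and s0: "s0 \<in> \<T>" and g0: "\<forall>v\<in>s0. u v = g0 \<bullet> emb v + C0" and v: "v \<in> X"
  shows "g0 \<bullet> emb v + C0 \<le> u v"
proof (rule ccontr)
  assume neg: "\<not> ?thesis"
  have "\<forall>s\<in>\<T>. \<exists>gC :: (real \<times> real) \<times> real. \<forall>v\<in>s. u v = fst gC \<bullet> emb v + snd gC"
    by (intro ballI affine_interpolation tri_unimodular[OF T])
  from bchoice[OF this] obtain F' :: "point set \<Rightarrow> (real \<times> real) \<times> real"
    where F': "\<forall>s\<in>\<T>. \<forall>v\<in>s. u v = fst (F' s) \<bullet> emb v + snd (F' s)" by (rule exE)
  define F where "F = F'(s0 := (g0, C0))"
  define L where "L s p = fst (F s) \<bullet> p + snd (F s)" for s p
  have F: "\<forall>v\<in>s. u v = fst (F s) \<bullet> emb v + snd (F s)" if "s \<in> \<T>" for s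
    using F' g0 that by (cases "s = s0") (simp_all add: F_def)
  have Lu: "L s (emb a) = u a" if "s \<in> \<T>" "a \<in> s" for s a
    using F[OF that(1)] that(2) by (simp add: L_def)
  have Lb: "(\<Sum>v\<in>X. w v * u v) = L s p" if "s \<in> \<T>" "bary X s w p" for s w p
    unfolding L_def by (rule bary_affine[OF that(2) F[OF that(1)]])
  have "\<T> \<subseteq> Pow X" by (intro subsetI PowI tri_subset[OF T])
  then have finT: "finite \<T>" using finite_X by (simp add: finite_subset)
  define M where "M = Max ((\<lambda>s. L s (emb v)) ` \<T>)"
  have LM: "L s (emb v) \<le> M" if "s \<in> \<T>" for s
    unfolding M_def using finT that by (intro Max_ge) auto
  have "L s0 (emb v) > u v" using neg by (simp add: L_def F_def)
  then have Mu: "M > u v" using LM[OF s0] by simp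
  have "M \<in> (\<lambda>s. L s (emb v)) ` \<T>" unfolding M_def using finT s0 by (intro Max_in) auto
  then obtain s1 where s1: "s1 \<in> \<T>" "L s1 (emb v) = M" by auto
  define R where "R = \<Union> (Hull ` {s \<in> \<T>. L s (emb v) = M})"
  have cR: "closed R" unfolding R_def
    using finT by (intro closed_Union) (auto intro!: compact_imp_closed compact_Hull tri_subset[OF T])
  have vR: "emb v \<notin> R"
  proof
    assume "emb v \<in> R"
    then obtain s where s: "s \<in> \<T>" "L s (emb v) = M" "emb v \<in> Hull s" by (auto simp: R_def)
    have "v \<in> s" by (rule vertex_in_Hull[OF T s(1) v s(3)])
    then show False using Lu[OF s(1)] s(2) Mu by simp
  qed
  obtain p0 where p0: "p0 \<in> Hull s1" and gen: "\<forall>v'\<in>X - {v}. cr (p0 - emb v) (emb v' - emb v) \<noteq> 0"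
    using generic_point[OF tri_unimodular[OF T s1(1)] tri_subset[OF T s1(1)]] by (rule bexE)
  have p0R: "p0 \<in> R" unfolding R_def using p0 s1 by blast
  have "Hull s1 \<subseteq> Hull X" unfolding Hull_def by (intro hull_mono image_mono tri_subset[OF T s1(1)])
  then have p0X: "p0 \<in> Hull X" using p0 by (rule subsetD)
  define \<gamma> where "\<gamma> \<theta> = p0 + \<theta> *\<^sub>R (emb v - p0)" for \<theta> :: real
  have cont: "continuous_on UNIV \<gamma>" unfolding \<gamma>_def by (intro continuous_intros)
  define S where "S = {0..1} \<inter> \<gamma> -` R"
  have "compact S" unfolding S_def
    by (intro compact_Int_closed compact_Icc closed_vimage cR cont)
  moreover have "0 \<in> S" using p0R by (simp add: S_def \<gamma>_def)
  ultimately obtain \<theta>0 where th: "\<theta>0 \<in> S" "\<forall>\<theta>\<in>S. \<theta> \<le> \<theta>0"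
    using compact_attains_sup[of S] by blast
  have "\<gamma> 1 = emb v" by (simp add: \<gamma>_def)
  then have "\<theta>0 \<noteq> 1" using th(1) vR by (auto simp: S_def)
  then have th0: "0 \<le> \<theta>0" "\<theta>0 < 1" using th(1) by (auto simp: S_def)
  obtain s' where s': "s' \<in> \<T>" "L s' (emb v) = M" "\<gamma> \<theta>0 \<in> Hull s'"
    using th(1) by (auto simp: S_def R_def)
  \<comment> \<open>The generic choice of \<open>p0\<close> keeps the line towards \<open>v\<close>
    away from all other grid points.\<close>
  have novertex: "\<forall>a\<in>X. \<gamma> \<theta>0 \<noteq> emb a"
  proof (intro ballI notI)
    fix a assume a: "a \<in> X" "\<gamma> \<theta>0 = emb a"
    have d: "emb a - emb v = (1 - \<theta>0) *\<^sub>R (p0 - emb v)" unfolding a(2)[symmetric] \<gamma>_def by (simp add: algebra_simps)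
    show False
    proof (cases "a = v")
      case True
      then have "(1 - \<theta>0) *\<^sub>R (p0 - emb v) = 0" using d by simp
      then have "p0 = emb v" using th0 by simp
      then show False using p0R vR by simp
    next
      case False
      then have "cr (p0 - emb v) (emb a - emb v) \<noteq> 0" using gen a by simp
      then show False unfolding d by (simp add: cr_def)
    qed
  qed
  \<comment> \<open>The triangles avoiding the last point form a closed set. Hence any triangle
    containing a slightly later point of the segment also contains the last point.\<close>
  define N where "N = \<Union> (Hull ` {s \<in> \<T>. \<gamma> \<theta>0 \<notin> Hull s})"
  have cN: "closed N" unfolding N_def
    using finT by (intro closed_Union) (auto intro!: compact_imp_closed compact_Hull tri_subset[OF T])
  have "open (\<gamma> -` (- N))" using cN cont by (intro open_vimage) auto
  moreover have "\<theta>0 \<in> \<gamma> -` (- N)" by (auto simp: N_def)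
  ultimately obtain \<delta> where \<delta>: "\<delta> > 0" "ball \<theta>0 \<delta> \<subseteq> \<gamma> -` (- N)"
    using open_contains_ball by blast
  define \<theta>1 where "\<theta>1 = \<theta>0 + min (\<delta> / 2) (1 - \<theta>0)"
  have th1: "\<theta>0 < \<theta>1" "\<theta>1 \<le> 1" using \<delta>(1) th0 by (simp_all add: \<theta>1_def)
  have "\<theta>1 \<in> ball \<theta>0 \<delta>" using \<delta>(1) th0 by (auto simp: \<theta>1_def dist_real_def)
  then have notN: "\<gamma> \<theta>1 \<notin> N" using \<delta>(2) by auto
  have "\<gamma> \<theta>1 \<in> Hull X" unfolding \<gamma>_def using th0 th1 by (intro convex_combination_mem p0X v) auto
  from tri_cover[OF T this] obtain s'' w'' where s'': "s'' \<in> \<T>" and w'': "bary X s'' w'' (\<gamma> \<theta>1)"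
    by (elim bexE exE)
  have in'': "\<gamma> \<theta>1 \<in> Hull s''" 
    by (rule iffD2[OF Hull_iff_bary[OF finite_X tri_subset[OF T s'']]]) (rule exI, rule w'')
  then have on'': "\<gamma> \<theta>0 \<in> Hull s''" using notN s'' by (auto simp: N_def)
  have "\<theta>1 \<notin> S" using th(2) th1 by auto
  then have "\<gamma> \<theta>1 \<notin> R" using th0 th1 by (simp add: S_def)
  then have "L s'' (emb v) \<noteq> M" using in'' s'' by (auto simp: R_def)
  then have less: "L s'' (emb v) < M" using LM[OF s''] by simp
  obtain w where w: "bary X s' w (\<gamma> \<theta>0)" using s'(3) unfolding Hull_iff_bary[OF finite_X tri_subset[OF T s'(1)]] by (rule exE)
  obtain w2 where w2: "bary X s'' w2 (\<gamma> \<theta>0)" using on'' unfolding Hull_iff_bary[OF finite_X tri_subset[OF T s'']] by (rule exE)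
  have ww: "w2 = w" by (rule tri_conform[OF T s'' s'(1) w2 w])
  have w3: "bary X s'' w (\<gamma> \<theta>0)" using w2 unfolding ww .
  have "s' \<noteq> s''" using less s'(2) by auto
  from common_edge[OF T s'(1) s'' this w w3 novertex]
  obtain a b c d where e: "s' = {a, b, c}" "s'' = {a, b, d}" "c \<noteq> d" by (elim exE conjE)
  have D0: "L s'' (\<gamma> \<theta>0) = L s' (\<gamma> \<theta>0)" using Lb[OF s'(1) w] Lb[OF s'' w3] by simp
  have "L s' (emb d) \<le> u d"
    unfolding L_def using LC[of a b c d] s'(1) s'' e(3) F[OF s'(1)] unfolding e by blast
  then have le: "L s' (emb q) \<le> u q" if "q \<in> s''" for q
    using that Lu[OF s'(1), of q] unfolding e by (elim insertE emptyE) simp_all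
  have "L s' (\<gamma> \<theta>1) \<le> (\<Sum>q\<in>X. w'' q * u q)"
  proof -
    have "L s' (\<gamma> \<theta>1) = (\<Sum>q\<in>X. w'' q * L s' (emb q))"
      using bary_affine[OF w'', of "\<lambda>q. L s' (emb q)" "fst (F s')" "snd (F s')"] by (simp add: L_def)
    also have "\<dots> \<le> (\<Sum>q\<in>X. w'' q * u q)"
    proof (rule sum_mono)
      fix q
      show "w'' q * L s' (emb q) \<le> w'' q * u q"
        using le[of q] bary_nonneg[OF w'', of q] bary_zero[OF w'', of q]
        by (cases "q \<in> s''") (simp_all add: mult_left_mono)
    qed
    finally show ?thesis .
  qed
  then have D1: "L s' (\<gamma> \<theta>1) \<le> L s'' (\<gamma> \<theta>1)" using Lb[OF s'' w''] by simp
  \<comment> \<open>Along the segment both extensions are affine in \<theta>. They agree at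
    \<open>\<theta>0\<close> and that of \<open>s''\<close> is smaller at 1, hence also at
    \<open>\<theta>1\<close>, which contradicts \<open>D1\<close>.\<close>
  define A where "A s = fst (F s) \<bullet> (emb v - p0)" for s
  have lin: "L s (\<gamma> \<theta>) = L s p0 + \<theta> * A s" for s \<theta>
    by (simp add: L_def \<gamma>_def A_def inner_add_right)
  have "L s'' p0 + A s'' < L s' p0 + A s'"
    using less s'(2) lin[of s' 1] lin[of s'' 1] \<open>\<gamma> 1 = emb v\<close> by simp
  moreover have eq0: "L s'' p0 + \<theta>0 * A s'' = L s' p0 + \<theta>0 * A s'" using D0 by (simp add: lin)
  ultimately have "(1 - \<theta>0) * (A s'' - A s') < 0" by (simp add: algebra_simps)
  then have "A s'' - A s' < 0" using th0 by (simp add: mult_less_0_iff)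
  then have "(\<theta>1 - \<theta>0) * (A s'' - A s') < 0" using th1 by (simp add: mult_less_0_iff)
  then show False using D1 eq0 by (simp add: lin algebra_simps)
qed

text \<open>Affine pieces lying below \<open>u\<close> on \<open>X\<close> lie below the
  interpolation on the hull, by averaging. Each point thus has a supporting affine function, which
  gives convexity.\<close>

lemma delaunayI:
  assumes T: "tri X \<T>"
    and sup: "\<And>s g C v. s \<in> \<T> \<Longrightarrow> \<forall>v\<in>s. u v = g \<bullet> emb v + C \<Longrightarrow> v \<in> X \<Longrightarrow> g \<bullet> emb v + C \<le> u v"
  shows "delaunay X u \<T>"
proof -
  have below: "g \<bullet> p + C \<le> interp \<T> u p"
    if s: "s \<in> \<T>" "\<forall>v\<in>s. u v = g \<bullet> emb v + C" and p: "p \<in> Hull X" for s g C p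
  proof -
    obtain s' w where s': "s' \<in> \<T>" "bary X s' w p" using tri_cover[OF T p] by (elim bexE exE)
    have "g \<bullet> p + C = (\<Sum>v\<in>X. w v * (g \<bullet> emb v + C))"
      using bary_affine[OF s'(2), of "\<lambda>v. g \<bullet> emb v + C" g C] by simp
    also have "\<dots> \<le> (\<Sum>v\<in>X. w v * u v)"
      using sup[OF s] bary_nonneg[OF s'(2)] by (intro sum_mono mult_left_mono) auto
    also have "\<dots> = interp \<T> u p" by (rule interp_eq[OF T s', symmetric])
    finally show ?thesis .
  qed
  have "convex_on (Hull X) (interp \<T> u)"
    unfolding convex_on_def
  proof (intro conjI ballI allI impI)
    show cv: "convex (Hull X)" by (simp add: Hull_def)
    fix x y and l m :: real assume h: "x \<in> Hull X" "y \<in> Hull X" "0 \<le> l" "0 \<le> m" "l + m = 1"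
    have "l *\<^sub>R x + m *\<^sub>R y \<in> Hull X" using h by (intro convexD[OF cv])
    from tri_cover[OF T this] obtain s w where s: "s \<in> \<T>" "bary X s w (l *\<^sub>R x + m *\<^sub>R y)" by (elim bexE exE)
    obtain gC :: "(real \<times> real) \<times> real" where gC: "\<forall>v\<in>s. u v = fst gC \<bullet> emb v + snd gC"
      using affine_interpolation[OF tri_unimodular[OF T s(1)]] by (rule exE)
    have "interp \<T> u (l *\<^sub>R x + m *\<^sub>R y) = fst gC \<bullet> (l *\<^sub>R x + m *\<^sub>R y) + (l + m) * snd gC"
      using interp_eq[OF T s] bary_affine[OF s(2) gC] h(5) by simp
    also have "\<dots> = l * (fst gC \<bullet> x + snd gC) + m * (fst gC \<bullet> y + snd gC)"
      by (simp add: algebra_simps inner_add_right)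
    also have "\<dots> \<le> l * interp \<T> u x + m * interp \<T> u y"
      using below[OF s(1) gC] h by (intro add_mono mult_left_mono) auto
    finally show "interp \<T> u (l *\<^sub>R x + m *\<^sub>R y) \<le> l * interp \<T> u x + m * interp \<T> u y" .
  qed
  then show ?thesis unfolding delaunay_def using tri_triangulation[OF T] by (intro conjI)
qed

end

section \<open>Flipping to a Delaunay triangulation\<close>

lemma acute_basis_unique_unordered:
  assumes d: "\<bar>det2 f g\<bar> = 1" "\<bar>det2 f' g'\<bar> = 1" and i: "ip f g \<ge> 0" "ip f' g' \<ge> 0"
    and e: "f + g = f' + g'"
  shows "{f', g'} = {f, g}"
proof -
  have s: "det2 b a = - det2 a b" "ip b a = ip a b" for a b by (simp_all add: det2_def ip_def)
  obtain a b where ab: "{a, b} = {f, g}" "det2 a b = 1" "ip a b \<ge> 0" "a + b = f + g"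
  proof (cases "det2 f g = 1")
    case True
    then show ?thesis using that[of f g] i by simp
  next
    case False
    then have "det2 g f = 1" using d s(1)[of g f] by linarith
    then show ?thesis using that[of g f] i s(2)[of g f] by (simp add: insert_commute add.commute)
  qed
  obtain a' b' where ab': "{a', b'} = {f', g'}" "det2 a' b' = 1" "ip a' b' \<ge> 0" "a' + b' = f' + g'"
  proof (cases "det2 f' g' = 1")
    case True
    then show ?thesis using that[of f' g'] i by simp
  next
    case False
    then have "det2 g' f' = 1" using d s(1)[of g' f'] by linarith
    then show ?thesis using that[of g' f'] i s(2)[of g' f'] by (simp add: insert_commute add.commute)
  qed
  have "a' = a \<and> b' = b"
    using ab(4) ab'(4) e by (intro acute_basis_unique[OF ab(2) ab'(2) ab(3) ab'(3)]) simp
  then show ?thesis using ab(1) ab'(1) by simp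
qed

context flip begin

lemma interp_flip_le:
  assumes le: "u y + u z \<le> u x + u t" and p: "p \<in> Hull X"
  shows "interp \<T>' u p \<le> interp \<T> u p"
proof -
  obtain s w where s: "s \<in> \<T>" "bary X s w p" using tri_cover[OF T p] by (elim bexE exE)
  obtain s' w' where s': "s' \<in> \<T>'" "bary X s' w' p"
    and eq: "(\<Sum>v\<in>X. w' v * u v) = (\<Sum>v\<in>X. w v * u v) + min (w x) (w t) * (u y + u z - u x - u t)"
    using flip_value[OF s, of u] by (elim bexE exE conjE)
  have "min (w x) (w t) \<ge> 0" using bary_nonneg[OF s(2)] by simp
  then have "min (w x) (w t) * (u y + u z - u x - u t) \<le> 0" using le by (intro mult_nonneg_nonpos) simp_all
  then show ?thesis unfolding interp_eq[OF T s] interp_eq[OF tri_flip s'] eq by simp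
qed

lemma interp_flip_mid:
  "interp \<T>' u ((1/2) *\<^sub>R emb y + (1/2) *\<^sub>R emb z) = (u y + u z) / 2"
  "interp \<T> u ((1/2) *\<^sub>R emb y + (1/2) *\<^sub>R emb z) = (u x + u t) / 2"
proof -
  have "{x, y, z} \<in> \<T>'" by (simp add: \<T>'_def)
  then show "interp \<T>' u ((1/2) *\<^sub>R emb y + (1/2) *\<^sub>R emb z) = (u y + u z) / 2"
    by (rule interp_mid[OF tri_flip]) (simp_all add: yz)
  have h: "(1::real) - 1/2 = 1/2" by simp
  have "x \<noteq> t" using dist by auto
  then show "interp \<T> u ((1/2) *\<^sub>R emb y + (1/2) *\<^sub>R emb z) = (u x + u t) / 2"
    unfolding half[unfolded h, symmetric] by (intro interp_mid[OF T mem(1)]) simp_all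
qed

end

text \<open>Invariant of the flips. The hypotheses are never satisfied in a standard Delaunay triangulation; the
  conclusion prevents an edge which is a long diagonal from being flipped into the short one.\<close>

definition no_long_edges :: "point set \<Rightarrow> (point \<Rightarrow> real) \<Rightarrow> point set set \<Rightarrow> bool" where
  "no_long_edges X u \<T> \<longleftrightarrow> (\<forall>s\<in>\<T>. \<forall>a f g. a \<in> s \<longrightarrow> a + f + g \<in> s \<longrightarrow> \<bar>det2 f g\<bar> = 1 \<longrightarrow> ip f g > 0 \<longrightarrow>
     a + f \<in> X \<longrightarrow> a + g \<in> X \<longrightarrow> u a + u (a + f + g) \<le> u (a + f) + u (a + g))"

lemma no_long_edgesD:
  assumes "no_long_edges X u \<T>" "s \<in> \<T>" "a \<in> s" "b \<in> s" "a + f + g = b" "\<bar>det2 f g\<bar> = 1" "ip f g > 0"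
    "a + f \<in> X" "a + g \<in> X"
  shows "u a + u b \<le> u (a + f) + u (a + g)"
proof -
  have "a + f + g \<in> s" using assms(4,5) by simp
  then show ?thesis using assms(1-3,6-) unfolding no_long_edges_def assms(5)[symmetric] by blast
qed

lemma q_eq: "q p = real_of_int (ip p p) / 2"
proof -
  have "(norm (emb p))\<^sup>2 = emb p \<bullet> emb p" by (simp add: power2_norm_eq_inner)
  then show ?thesis unfolding q_def inner_emb by simp
qed

context lattice_polygon begin

text \<open>Comparing at the common midpoint of the diagonals, convexity bounds
  \<open>q a + q (a + f + g)\<close> by \<open>q (a + f) + q (a + g)\<close>, but the difference is
  \<open>ip f g > 0\<close>. The strict sign matters: in a unit square either diagonal can
  occur.\<close>

lemma standard_delaunay_no_long_edges:
  assumes D: "standard_delaunay X \<T>"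
  shows "no_long_edges X u \<T>"
  unfolding no_long_edges_def
proof (intro ballI allI impI)
  fix s a f g
  assume s: "s \<in> \<T>" "a \<in> s" "a + f + g \<in> s" and d: "\<bar>det2 f g\<bar> = 1" and i: "ip f g > 0"
    and X: "a + f \<in> X" "a + g \<in> X"
  have T: "tri X \<T>" using D unfolding standard_delaunay_def delaunay_def by (intro triangulation_tri) (elim conjE)
  have cv: "convex_on (Hull X) (interp \<T> q)" using D unfolding standard_delaunay_def delaunay_def by (elim conjE)
  have H: "emb v \<in> Hull X" if "v \<in> X" for v unfolding Hull_def by (rule hull_inc) (rule imageI[OF that])
  have "f + g \<noteq> 0"
  proof
    assume "f + g = 0"
    then have "g = - f" by (simp add: eq_neg_iff_add_eq_0 add.commute)
    then show False using d by (simp add: det2_def)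
  qed
  then have ne: "a \<noteq> a + f + g" by (simp add: add.assoc)
  have mid: "(1/2) *\<^sub>R emb a + (1/2) *\<^sub>R emb (a + f + g) = (1/2) *\<^sub>R emb (a + f) + (1/2) *\<^sub>R emb (a + g)"
    by (simp add: emb_add algebra_simps)
  have "(q a + q (a + f + g)) / 2 = interp \<T> q ((1/2) *\<^sub>R emb (a + f) + (1/2) *\<^sub>R emb (a + g))"
    using interp_mid[OF T s ne, of q] unfolding mid by simp
  also have "\<dots> \<le> (1/2) * interp \<T> q (emb (a + f)) + (1/2) * interp \<T> q (emb (a + g))"
    using convex_onD[OF cv, of "1/2" "emb (a + f)" "emb (a + g)"] H[OF X(1)] H[OF X(2)] by simp
  also have "\<dots> = (q (a + f) + q (a + g)) / 2"
    unfolding interp_vertex[OF T X(1)] interp_vertex[OF T X(2)] by simp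
  finally have "q a + q (a + f + g) \<le> q (a + f) + q (a + g)" by simp
  moreover have "ip a a + ip (a + f + g) (a + f + g) = ip (a + f) (a + f) + ip (a + g) (a + g) + 2 * ip f g"
    by (simp add: ip_def algebra_simps)
  then have "real_of_int (ip a a) + real_of_int (ip (a + f + g) (a + f + g)) =
      real_of_int (ip (a + f) (a + f)) + real_of_int (ip (a + g) (a + g)) + 2 * real_of_int (ip f g)"
    by (metis of_int_add of_int_mult of_int_numeral)
  ultimately have "real_of_int (ip f g) \<le> 0" unfolding q_eq by simp
  then show "u a + u (a + f + g) \<le> u (a + f) + u (a + g)" using i by simp
qed

end

section \<open>Flips that lower the interpolation\<close>

locale improving_flip = flip +
  fixes u :: "point \<Rightarrow> real"
  assumes inv: "no_long_edges X u \<T>" and improves: "u y + u z < u x + u t"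
begin

text \<open>An obtuse angle at \<open>y\<close> means an acute one at \<open>x\<close>, so that
  \<open>[x, t]\<close> would be the long diagonal. The invariant then forbids an
  improvement.\<close>

lemma new_edge_basis: "\<bar>det2 (x - y) (t - y)\<bar> = 1" "ip (x - y) (t - y) \<ge> 0"
proof -
  have z: "z = x + t - y" using par by (simp add: algebra_simps)
  have "\<bar>det2 (y - x) (t - x)\<bar> = 1" by (rule unimodular_det2[OF tri_unimodular[OF T mem(1)]])
  moreover have "det2 (x - y) (t - y) = - det2 (y - x) (t - x)" "det2 (y - x) (z - x) = - det2 (t - x) (y - x)"
    "det2 (t - x) (y - x) = - det2 (y - x) (t - x)"
    by (simp_all add: z det2_def algebra_simps)
  ultimately have e: "\<bar>det2 (x - y) (t - y)\<bar> = 1" and d: "\<bar>det2 (y - x) (z - x)\<bar> = 1" by linarith+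
  show "\<bar>det2 (x - y) (t - y)\<bar> = 1" by (rule e)
  show "ip (x - y) (t - y) \<ge> 0"
  proof (rule ccontr)
    assume n: "\<not> ?thesis"
    have "ip (y - x) (z - x) = - ip (x - y) (t - y)" by (simp add: z ip_def algebra_simps)
    then have i: "ip (y - x) (z - x) > 0" using n by simp
    have "u x + u t \<le> u (x + (y - x)) + u (x + (z - x))"
      by (rule no_long_edgesD[OF inv mem(1) _ _ _ d i]) (use sub in \<open>simp_all add: z algebra_simps\<close>)
    then show False using improves by simp
  qed
qed

text \<open>Only \<open>[y, z]\<close> is new. By uniqueness of acute bases the sides
  \<open>f\<close>, \<open>g\<close> lead to \<open>x\<close> and \<open>t\<close>, and the required
  inequality is the improvement itself.\<close>

lemma flip_no_long_edges: "no_long_edges X u \<T>'"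
  unfolding no_long_edges_def
proof (intro ballI allI impI)
  fix s a f g
  assume s: "s \<in> \<T>'" "a \<in> s" "a + f + g \<in> s" and d: "\<bar>det2 f g\<bar> = 1" and i: "ip f g > 0"
    and X: "a + f \<in> X" "a + g \<in> X"
  define b where "b = a + f + g"
  have old: "u a + u b \<le> u (a + f) + u (a + g)" if "r \<in> \<T>" "a \<in> r" "b \<in> r" for r
    by (rule no_long_edgesD[OF inv that b_def[symmetric] d i X])
  have ne: "a \<noteq> b"
  proof
    assume "a = b"
    then have "g = - f" by (simp add: b_def add.assoc eq_neg_iff_add_eq_0 add.commute)
    then show False using d by (simp add: det2_def)
  qed
  have new: "u a + u b \<le> u (a + f) + u (a + g)" if ab: "a = y \<and> b = z \<or> a = z \<and> b = y"
  proof -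
    have "{f, g} = {x - a, t - a}"
    proof (rule acute_basis_unique_unordered)
      have z: "z = x + t - y" using par by (simp add: algebra_simps)
      have "det2 (x - z) (t - z) = - det2 (x - y) (t - y)" "ip (x - z) (t - z) = ip (x - y) (t - y)"
        by (simp_all add: z det2_def ip_def algebra_simps)
      then show "\<bar>det2 (x - a) (t - a)\<bar> = 1" "ip (x - a) (t - a) \<ge> 0"
        using new_edge_basis ab by (elim disjE; simp)+
      have "x + t = a + b" using ab par by (auto simp: add.commute)
      then show "x - a + (t - a) = f + g" by (simp add: b_def algebra_simps)
    qed (use d i in simp_all)
    then have "f = x - a \<and> g = t - a \<or> f = t - a \<and> g = x - a" by (auto simp: doubleton_eq_iff)
    then have "u (a + f) + u (a + g) = u x + u t" by (elim disjE) simp_all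
    moreover have "u a + u b = u y + u z" using ab by (elim disjE) simp_all
    ultimately show ?thesis using improves by simp
  qed
  consider "s \<in> \<T>" | "s = {x, y, z}" | "s = {t, y, z}" using s(1) unfolding \<T>'_def by blast
  then have "u a + u b \<le> u (a + f) + u (a + g)"
  proof cases
    case 1
    then show ?thesis using old s unfolding b_def by blast
  next
    case 2
    then have "(a \<in> {x, y, t} \<and> b \<in> {x, y, t}) \<or> (a \<in> {x, z, t} \<and> b \<in> {x, z, t}) \<or> (a = y \<and> b = z \<or> a = z \<and> b = y)"
      using s(2,3) ne unfolding b_def[symmetric] by blast
    then show ?thesis using old[OF mem(1)] old[OF mem(2)] new by blast
  next
    case 3
    then have "(a \<in> {x, y, t} \<and> b \<in> {x, y, t}) \<or> (a \<in> {x, z, t} \<and> b \<in> {x, z, t}) \<or> (a = y \<and> b = z \<or> a = z \<and> b = y)"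
      using s(2,3) ne unfolding b_def[symmetric] by blast
    then show ?thesis using old[OF mem(1)] old[OF mem(2)] new by blast
  qed
  then show "u a + u (a + f + g) \<le> u (a + f) + u (a + g)" unfolding b_def .
qed

end

section \<open>Counting the flips against the stencils\<close>

context stencil_cone begin

text \<open>Edges on which the interpolation of \<open>u\<close> is still too large: a potential decreasing with every flip.\<close>

definition pending :: "point set set \<Rightarrow> (point \<times> point) set" where
  "pending \<T> = {(y, e) \<in> Sigma X V. interp \<T> u ((1/2) *\<^sub>R emb y + (1/2) *\<^sub>R emb (y + e)) > (u y + u (y + e)) / 2}"

lemma finite_V: "x \<in> X \<Longrightarrow> finite (V x)"
proof -
  assume x: "x \<in> X"
  have "V x \<subseteq> (\<lambda>p. p - x) ` X"
  proof
    fix e assume "e \<in> V x"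
    then have "x + e \<in> X" using V_Vmax[OF x] by (simp add: Vmax_def)
    then show "e \<in> (\<lambda>p. p - x) ` X" by (intro image_eqI[of _ _ "x + e"]) simp_all
  qed
  then show ?thesis using finite_X finite_subset by blast
qed

lemma finite_pending: "finite (pending \<T>)" and card_pending: "card (pending \<T>) \<le> stencils_card X V"
proof -
  have fin: "finite (Sigma X V)" using finite_X finite_V by (intro finite_SigmaI)
  have sub: "pending \<T> \<subseteq> Sigma X V" unfolding pending_def by blast
  show "finite (pending \<T>)" using fin sub finite_subset by blast
  have "card (Sigma X V) = stencils_card X V"
    unfolding stencils_card_def using finite_X finite_V by (intro card_SigmaI) simp_all
  then show "card (pending \<T>) \<le> stencils_card X V" using card_mono[OF fin sub] by simp
qed

text \<open>The midpoint of \<open>[y, z]\<close> is interpolated along \<open>[x, t]\<close> before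
  the flip and along \<open>[y, z]\<close> after it, so \<open>(y, z - y)\<close> is removed.
  Nothing is added, because the interpolation increases nowhere.\<close>

lemma improving_flip_pending:
  assumes "improving_flip X \<T> x t y z u"
  shows "pending (flip.\<T>' \<T> x t y z) \<subset> pending \<T>"
proof -
  interpret improving_flip X \<T> x t y z u by fact
  have le: "u y + u z \<le> u x + u t" using improves by simp
  have yzX: "y \<in> X" "z \<in> X" "x \<in> X" "t \<in> X" using sub by simp_all
  have "z - y \<in> V y"
  proof -
    define f g where "f = x - y" and "g = t - y"
    have zy: "z - y = f + g" "y + (z - y) = z" "y + f = x" "y + g = t"
      using par by (simp_all add: f_def g_def algebra_simps)
    have P: "P_form (z - y) f g y u < 0" "P_form (z - y) g f y u < 0"
      unfolding P_form_def zy(2-) using improves by simp_all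
    have d: "det2 f g = 1 \<or> det2 g f = 1" using new_edge_basis(1) det2_swap[of g f] unfolding f_def g_def by linarith
    have i: "ip f g \<ge> 0" "ip g f \<ge> 0" using new_edge_basis(2) by (simp_all add: f_def g_def ip_def algebra_simps)
    have zX: "y + (z - y) \<in> X" using yzX by simp
    from d show ?thesis
    proof
      assume "det2 f g = 1"
      then have "parents (z - y) f g" using i zy(1) by (simp add: parents_iff)
      then show ?thesis using P_neg_in_V[OF yzX(1) zX _ P(1)] by blast
    next
      assume "det2 g f = 1"
      then have "parents (z - y) g f" using i zy(1) by (simp add: parents_iff add.commute)
      then show ?thesis using P_neg_in_V[OF yzX(1) zX _ P(2)] by blast
    qed
  qed
  then have "(y, z - y) \<in> Sigma X V" using yzX by simp
  moreover have yz': "y + (z - y) = z" by simp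
  ultimately have 1: "(y, z - y) \<in> pending \<T>" "(y, z - y) \<notin> pending \<T>'"
    unfolding pending_def using interp_flip_mid[of u] improves by (simp_all only: mem_Collect_eq prod.case yz') simp_all
  have "pending \<T>' \<subseteq> pending \<T>"
  proof
    fix ye assume "ye \<in> pending \<T>'"
    then obtain a e where ye: "ye = (a, e)" "a \<in> X" "e \<in> V a"
      and gt: "interp \<T>' u ((1/2) *\<^sub>R emb a + (1/2) *\<^sub>R emb (a + e)) > (u a + u (a + e)) / 2"
      by (auto simp: pending_def)
    have aX: "a + e \<in> X" using V_Vmax[OF ye(2,3)] by (simp add: Vmax_def)
    have "emb a + (1/2) *\<^sub>R (emb (a + e) - emb a) \<in> Hull X"
      unfolding Hull_def[of X] by (intro convex_combination_mem[unfolded Hull_def] hull_inc imageI ye(2) aX) simp_all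
    moreover have "emb a + (1/2) *\<^sub>R (emb (a + e) - emb a) = (1/2) *\<^sub>R emb a + (1/2) *\<^sub>R emb (a + e)"
      by (simp add: algebra_simps flip: scaleR_add_left)
    ultimately have "(1/2) *\<^sub>R emb a + (1/2) *\<^sub>R emb (a + e) \<in> Hull X" by simp
    from interp_flip_le[OF le this] gt show "ye \<in> pending \<T>" using ye by (simp add: pending_def)
  qed
  then show ?thesis using 1 by blast
qed

lemma improving_flip_exists:
  assumes T: "tri X \<T>" and inv: "no_long_edges X u \<T>" and nd: "\<not> delaunay X u \<T>"
  obtains x t y z where "improving_flip X \<T> x t y z u"
proof -
  have "\<exists>a b c d g C. {a, b, c} \<in> \<T> \<and> {a, b, d} \<in> \<T> \<and> c \<noteq> d \<and>
      (\<forall>v\<in>{a, b, c}. u v = g \<bullet> emb v + C) \<and> \<not> g \<bullet> emb d + C \<le> u d"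
  proof (rule ccontr)
    assume n: "\<not> ?thesis"
    have "delaunay X u \<T>"
    proof (rule delaunayI[OF T])
      fix s g C v assume s: "s \<in> \<T>" "\<forall>v\<in>s. u v = g \<bullet> emb v + C" "v \<in> X"
      show "g \<bullet> emb v + C \<le> u v"
      proof (rule local_to_global[OF T _ s])
        fix a b c d g C
        assume "{a, b, c} \<in> \<T>" "{a, b, d} \<in> \<T>" "c \<noteq> d" "\<forall>v\<in>{a, b, c}. u v = g \<bullet> emb v + C"
        then show "g \<bullet> emb d + C \<le> u d" using n by blast
      qed
    qed
    then show False using nd by simp
  qed
  then obtain a b c d g C where m: "{a, b, c} \<in> \<T>" "{a, b, d} \<in> \<T>" and cd: "c \<noteq> d"
    and g: "\<forall>v\<in>{a, b, c}. u v = g \<bullet> emb v + C" and neg: "\<not> g \<bullet> emb d + C \<le> u d" by (elim exE conjE)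
  obtain k where k: "d - a = (k * fst (b - a) - fst (c - a), k * snd (b - a) - snd (c - a))"
    using opposite_vertex[OF T m cd[symmetric]] .
  have X: "a \<in> X" "b \<in> X" "c \<in> X" "d \<in> X" using tri_subset[OF T m(1)] tri_subset[OF T m(2)] by simp_all
  have fd: "fst (d - a) = k * fst (b - a) - fst (c - a)" "snd (d - a) = k * snd (b - a) - snd (c - a)"
    using k by simp_all
  have det: "\<bar>det2 (b - a) (c - a)\<bar> = 1" by (rule unimodular_det2[OF tri_unimodular[OF T m(1)]])
  have "emb d = emb a + real_of_int k *\<^sub>R (emb b - emb a) - (emb c - emb a)"
    using fd by (auto simp: emb_def algebra_simps simp flip: of_int_mult of_int_add of_int_diff)
  then have "g \<bullet> emb d = g \<bullet> (emb a + real_of_int k *\<^sub>R (emb b - emb a) - (emb c - emb a))" by (rule arg_cong)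
  then have "g \<bullet> emb d = g \<bullet> emb a + k * (g \<bullet> emb b - g \<bullet> emb a) - (g \<bullet> emb c - g \<bullet> emb a)"
    by (simp only: inner_add_right inner_diff_right inner_scaleR_right)
  then have "g \<bullet> emb d + C = u a + k * (u b - u a) - (u c - u a)" using g by simp
  then have lt: "u c + u d < (2 - k) * u a + k * u b" using neg by (simp add: algebra_simps)
  \<comment> \<open>For \<open>k \<le> 0\<close> convexity around \<open>a\<close> applies with
    \<open>m = - k\<close>. For \<open>k \<ge> 2\<close> the ends of the edge exchange roles, and
    around \<open>b\<close> the parameter is \<open>m = k - 2\<close>.\<close>
  have "k = 1"
  proof (rule ccontr)
    assume "k \<noteq> 1"
    then consider "k \<le> 0" | "k \<ge> 2" by linarith
    then show False
    proof cases
      case 1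
      have "u (a + (c - a)) + u (a + (d - a)) + real (nat (- k)) * u (a + (b - a)) \<ge> (real (nat (- k)) + 2) * u a"
        by (rule local_convex) (use X det fd 1 in simp_all)
      then show False using lt 1 by (simp add: algebra_simps)
    next
      case 2
      have "u (b + (c - b)) + u (b + (d - b)) + real (nat (k - 2)) * u (b + (a - b)) \<ge> (real (nat (k - 2)) + 2) * u b"
      proof (rule local_convex)
        have "det2 (a - b) (c - b) = - det2 (b - a) (c - a)" by (simp add: det2_def algebra_simps)
        then show "\<bar>det2 (a - b) (c - b)\<bar> = 1" using det by simp
        show "fst (d - b) = - fst (c - b) - int (nat (k - 2)) * fst (a - b)"
          "snd (d - b) = - snd (c - b) - int (nat (k - 2)) * snd (a - b)"
          using fd 2 by (simp_all add: algebra_simps)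
      qed (use X in simp_all)
      then show False using lt 2 by (simp add: algebra_simps)
    qed
  qed
  then have "d = b + a - c" using fd by (simp add: prod_eq_iff)
  then have "a + b = c + d" by (simp add: algebra_simps)
  moreover have "{a, c, b} \<in> \<T>" "{a, d, b} \<in> \<T>" using m by (simp_all add: insert_commute)
  ultimately have "flip X \<T> a b c d"
    using T cd lattice_polygon_axioms by (intro flip.intro flip_axioms.intro)
  then have "improving_flip X \<T> a b c d u"
    using inv lt \<open>k = 1\<close> by (intro improving_flip.intro improving_flip_axioms.intro) simp_all
  then show thesis by (rule that)
qed

lemma flip_sequence:
  assumes "tri X \<T>" "no_long_edges X u \<T>"
  shows "\<exists>n \<T>'. n \<le> card (pending \<T>) \<and> (edge_flip ^^ n) \<T> \<T>' \<and> delaunay X u \<T>'"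
  using assms
proof (induction "card (pending \<T>)" arbitrary: \<T> rule: less_induct)
  case less
  show ?case
  proof (cases "delaunay X u \<T>")
    case True
    then show ?thesis by (intro exI[of _ "0::nat"] exI[of _ \<T>]) simp
  next
    case False
    then obtain x t y z where fl: "improving_flip X \<T> x t y z u" using improving_flip_exists[OF less.prems] by metis
    interpret improving_flip X \<T> x t y z u by fact
    have lt: "card (pending \<T>') < card (pending \<T>)"
      by (rule psubset_card_mono[OF finite_pending improving_flip_pending[OF fl]])
    obtain n \<T>'' where n: "n \<le> card (pending \<T>')" "(edge_flip ^^ n) \<T>' \<T>''" "delaunay X u \<T>''"
      using less.hyps[OF lt tri_flip flip_no_long_edges] by (elim exE conjE)
    have "(edge_flip ^^ Suc n) \<T> \<T>''" by (rule relpowp_Suc_I2[OF edge_flip n(2)])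
    moreover have "Suc n \<le> card (pending \<T>)" using n(1) lt by simp
    ultimately show ?thesis using n(3) by (intro exI[of _ "Suc n"] exI[of _ \<T>''] conjI)
  qed
qed

end

lemma finite_grid:
  assumes "bounded \<Omega>" shows "finite (grid \<Omega>)"
proof -
  obtain B where B: "\<And>p. p \<in> \<Omega> \<Longrightarrow> norm p \<le> B" using assms by (auto simp: bounded_iff)
  have "grid \<Omega> \<subseteq> {- \<lceil>B\<rceil>..\<lceil>B\<rceil>} \<times> {- \<lceil>B\<rceil>..\<lceil>B\<rceil>}"
  proof
    fix p assume "p \<in> grid \<Omega>"
    then have "norm (emb p) \<le> B" using B by (simp add: grid_def)
    then have "\<bar>real_of_int (fst p)\<bar> \<le> B" "\<bar>real_of_int (snd p)\<bar> \<le> B"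
      using norm_fst_le[of "real_of_int (fst p)" "real_of_int (snd p)"] norm_snd_le[of "real_of_int (snd p)" "real_of_int (fst p)"]
      by (simp_all add: emb_def)
    then show "p \<in> {- \<lceil>B\<rceil>..\<lceil>B\<rceil>} \<times> {- \<lceil>B\<rceil>..\<lceil>B\<rceil>}"
      by (auto simp: mem_Times_iff) linarith+
  qed
  then show ?thesis by (rule finite_subset) simp
qed

theorem theorem1p15:
  shows "\<exists>C::real. \<forall>(\<Omega> :: (real \<times> real) set) (V :: point \<Rightarrow> point set) (u :: point \<Rightarrow> real) (\<T> :: point set set).
    compact \<Omega> \<longrightarrow> convex \<Omega> \<longrightarrow>
    interior (Hull (grid \<Omega>)) \<noteq> {} \<longrightarrow>
    stencils (grid \<Omega>) V \<longrightarrow> u \<in> Conv (grid \<Omega>) V \<longrightarrow>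
    standard_delaunay (grid \<Omega>) \<T> \<longrightarrow>
    (\<exists>n \<T>'. real n \<le> C * real (stencils_card (grid \<Omega>) V) \<and>
       (edge_flip ^^ n) \<T> \<T>' \<and> delaunay (grid \<Omega>) u \<T>')"
proof (rule exI[of _ 1], intro allI impI)
  fix \<Omega> :: "(real \<times> real) set" and V :: "point \<Rightarrow> point set" and u :: "point \<Rightarrow> real" and \<T> :: "point set set"
  assume \<Omega>: "compact \<Omega>" "convex \<Omega>" and V: "stencils (grid \<Omega>) V" and u: "u \<in> Conv (grid \<Omega>) V"
    and D: "standard_delaunay (grid \<Omega>) \<T>"
  have "Hull (grid \<Omega>) \<subseteq> \<Omega>" unfolding Hull_def by (rule hull_minimal) (auto simp: grid_def \<Omega>(2))
  then have "p \<in> grid \<Omega>" if "emb p \<in> Hull (grid \<Omega>)" for p using that by (auto simp: grid_def)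
  moreover have "finite (grid \<Omega>)" using \<Omega>(1) by (intro finite_grid compact_imp_bounded)
  ultimately interpret stencil_cone "grid \<Omega>" V u
    using V u by unfold_locales
  have T: "tri (grid \<Omega>) \<T>"
    using D unfolding standard_delaunay_def delaunay_def by (intro triangulation_tri) (elim conjE)
  obtain n \<T>' where n: "n \<le> card (pending \<T>)" "(edge_flip ^^ n) \<T> \<T>'" "delaunay (grid \<Omega>) u \<T>'"
    using flip_sequence[OF T standard_delaunay_no_long_edges[OF D]] by (elim exE conjE)
  have "real n \<le> 1 * real (stencils_card (grid \<Omega>) V)" using n(1) card_pending[of \<T>] by simp
  then show "\<exists>n \<T>'. real n \<le> 1 * real (stencils_card (grid \<Omega>) V) \<and>
       (edge_flip ^^ n) \<T> \<T>' \<and> delaunay (grid \<Omega>) u \<T>'"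
    using n(2,3) by (intro exI conjI)
qed

end
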